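(* (a) Let $R$ be a ring that is not a Jacobson ring. Then $R$ has a nonmaximal prime ideal $P$ such that $S:=R/P$ contains a nonzero element $b$ for which $A:=S[b^{-1}]$ is a field, and for such $P$ and $b$ one has $\dim(A)=0$ and $$1\le \operatorname{trdeg}(S)=\operatorname{trdeg}(S:R)\le\operatorname{trdeg}(A:R)\le\operatorname{trdeg}_{\mathrm{lex}}(A:R).$$ In particular, since $A$ is a finitely generated $R$-algebra and a Noetherian ring, neither the assertion "$\operatorname{trdeg}_{\mathrm{lex}}(A:R)=\dim(A)$ for every subfinite $R$-algebra $A$" nor the assertion "$\operatorname{trdeg}(A:R)=\dim(A)$ for every Noetherian subfinite $R$-algebra $A$" holds for $R$. (b) Let $R$ be a nonzero ring, $\mathfrak m$ a maximal ideal of $R$, $S:=(R/\mathfrak m)[x]$ the polynomial ring in one indeterminate, and $A:=\operatorname{Quot}(S)$ the field of fractions of $S$, considered as an $R$-algebra. Then $$\dim(A)=0<1=\operatorname{trdeg}(A:R/\mathfrak m)=\operatorname{trdeg}(A:R)=\operatorname{trdeg}_{\mathrm{lex}}(A:R).$$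
   Context: All rings are commutative with identity element $1$. An $R$-algebra is a ring $A$ together with a ring homomorphism $R\to A$; it is called subfinite if it is a subalgebra of a finitely generated $R$-algebra. $\dim$ denotes the Krull dimension. A Jacobson ring is a ring in which every prime ideal is an intersection of maximal ideals. A monomial ordering is a total ordering $\preceq$ on the set of monomials in infinitely many indeterminates $x_1,x_2,\ldots$ such that $1\preceq s$, and $st_1\preceq st_2$ whenever $t_1\preceq t_2$, for all monomials $s,t_1,t_2$. The symbol $\mathrm{lex}$ denotes the lexicographic ordering with $x_i>x_{i+1}$ for all $i$. Let $R$ be a ring. A nonzero polynomial $f\in R[x_1,x_2,\ldots]$ is submonic with respect to $\preceq$ if its trailing coefficient (the coefficient of the $\preceq$-least monomial having nonzero coefficient) is $1$. A polynomial is submonic if it is submonic with respect to some monomial ordering. Let $A$ be an $R$-algebra. Elements $a_1,\ldots,a_n\in A$ are algebraically dependent over $R$ if there is a submonic $f\in R[x_1,\ldots,x_n]$ with $f(a_1,\ldots,a_n)=0$ (the map $R\to A$ being applied to the coefficients of $f$); otherwise they are algebraically independent over $R$. If $f$ is required to be submonic with respect to a specified monomial ordering $\preceq$, one speaks of algebraic dependence or independence with respect to $\preceq$. The transcendence degree $\operatorname{trdeg}(A:R)$ is the supremum (possibly $\infty$) of all positive integers $n$ such that there exist $a_1,\ldots,a_n\in A$ that are algebraically independent over $R$; if every $a\in A$ is algebraically dependent over $R$, one sets $\operatorname{trdeg}(A:R):=0$ if $A\neq\{0\}$ and $\operatorname{trdeg}(A:R):=-1$ if $A=\{0\}$. One writes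 $\operatorname{trdeg}(R):=\operatorname{trdeg}(R:R)$. For a monomial ordering $\preceq$, $\operatorname{trdeg}_\preceq(A:R)$ is defined in the same way, using algebraic independence and dependence with respect to $\preceq$. *)

theory Defs
  imports "HOL-Algebra.Algebra" "HOL-Algebra.Indexed_Polynomials" "HOL-Algebra.UnivPoly"
    "HOL-Library.Extended_Real"
begin

section \<open>Monomial orderings and submonic polynomials\<close>

text \<open>
  Monomials in the indeterminates \<open>x\<^sub>0, x\<^sub>1, \<dots>\<close> (the paper's \<open>x\<^sub>1, x\<^sub>2, \<dots>\<close>) are finite multisets
  of indices, as in \<open>Indexed_Polynomials\<close>: the monomial \<open>1\<close> is the empty multiset and the product
  of monomials is the sum of multisets. Orderings are non-strict; \<open>(s, t) \<in> ord\<close> means that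
  \<open>s\<close> is at most \<open>t\<close>.
\<close>

definition monomial_ordering :: "nat multiset rel \<Rightarrow> bool" where
  "monomial_ordering ord \<longleftrightarrow> linear_order ord \<and> (\<forall>s. ({#}, s) \<in> ord) \<and>
     (\<forall>s t1 t2. (t1, t2) \<in> ord \<longrightarrow> (s + t1, s + t2) \<in> ord)"

definition lex_ordering :: "nat multiset rel" where
  "lex_ordering = {(s, t). s = t \<or>
     (\<exists>i. count s i < count t i \<and> (\<forall>j<i. count s j = count t j))}"

lemma lex_ordering_monomial_ordering: "monomial_ordering lex_ordering"
proof -
  have 1: "(s, t) \<in> lex_ordering \<or> (t, s) \<in> lex_ordering" for s t
  proof (cases "s = t")
    case False
    then have ex: "\<exists>i. count s i \<noteq> count t i" by (metis multiset_eqI)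
    define i where "i = (LEAST i. count s i \<noteq> count t i)"
    have "count s i \<noteq> count t i" using ex unfolding i_def by (rule LeastI_ex)
    moreover have "\<forall>j<i. count s j = count t j" unfolding i_def using not_less_Least by blast
    ultimately show ?thesis unfolding lex_ordering_def by (auto simp: neq_iff)
  qed (simp add: lex_ordering_def)
  have 2: "trans lex_ordering"
  proof (rule transI)
    fix s t u assume st: "(s, t) \<in> lex_ordering" and tu: "(t, u) \<in> lex_ordering"
    show "(s, u) \<in> lex_ordering"
    proof (cases "s = t \<or> t = u")
      case False
      then obtain i j where i: "count s i < count t i" "\<forall>k<i. count s k = count t k"
        and j: "count t j < count u j" "\<forall>k<j. count t k = count u k"
        using st tu unfolding lex_ordering_def by blast
      have "count s (min i j) < count u (min i j)"
        using i j by (metis less_trans linorder_neqE_nat min.absorb1 min.absorb2 less_imp_le order_refl min.idem)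
      moreover have "\<forall>k<min i j. count s k = count u k" using i j by simp
      ultimately show ?thesis unfolding lex_ordering_def by blast
    qed (use st tu in auto)
  qed
  have 3: "antisym lex_ordering"
  proof (rule antisymI)
    fix s t assume st: "(s, t) \<in> lex_ordering" and ts: "(t, s) \<in> lex_ordering"
    show "s = t"
    proof (rule ccontr)
      assume "s \<noteq> t"
      then obtain i j where "count s i < count t i" "\<forall>k<i. count s k = count t k"
        and "count t j < count s j" "\<forall>k<j. count t k = count s k"
        using st ts unfolding lex_ordering_def by blast
      then show False by (metis linorder_neqE_nat less_irrefl less_asym)
    qed
  qed
  have 4: "({#}, s) \<in> lex_ordering" for s
  proof (cases "s = {#}")
    case False
    then have ex: "\<exists>i. i \<in># s" by auto
    define i where "i = (LEAST i. i \<in># s)"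
    have "i \<in># s" using ex unfolding i_def by (rule LeastI_ex)
    moreover have "\<forall>j<i. j \<notin># s" unfolding i_def using not_less_Least by blast
    ultimately show ?thesis unfolding lex_ordering_def by (auto simp: not_in_iff)
  qed (simp add: lex_ordering_def)
  have 5: "(s + t1, s + t2) \<in> lex_ordering" if "(t1, t2) \<in> lex_ordering" for s t1 t2
    using that by (auto simp: lex_ordering_def)
  show ?thesis
    unfolding monomial_ordering_def linear_order_on_def partial_order_on_def preorder_on_def
    using 1 2 3 4 5 by (simp add: total_on_def refl_on_def) blast
qed

definition polys :: "('a, 'm) ring_scheme \<Rightarrow> nat \<Rightarrow> (nat multiset \<Rightarrow> 'a) set" where
  "polys R n = ring.indexed_pset R {..<n} (carrier R)"

lemma polys_iff:
  assumes "ring R"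
  shows "polys R n = {f. range f \<subseteq> carrier R \<and> finite {m. f m \<noteq> \<zero>\<^bsub>R\<^esub>} \<and>
                        (\<forall>m. f m \<noteq> \<zero>\<^bsub>R\<^esub> \<longrightarrow> set_mset m \<subseteq> {..<n})}" (is "_ = ?P")
proof -
  interpret ring R by fact
  note defs = indexed_const_def indexed_padd_def indexed_pmult_def
  have mono: "(\<lambda>m. if m = m0 then k else \<zero>\<^bsub>R\<^esub>) \<in> polys R n"
    if "set_mset m0 \<subseteq> {..<n}" "k \<in> carrier R" for m0 k
    using that(1)
  proof (induction m0)
    case empty
    then show ?case using indexed_pset.indexed_const[OF that(2), of "{..<n}"]
      by (simp add: polys_def defs)
  next
    case (add i m0)
    have "indexed_pmult (\<lambda>m. if m = m0 then k else \<zero>\<^bsub>R\<^esub>) i \<in> polys R n"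
      using add unfolding polys_def by (intro indexed_pset.indexed_pmult) auto
    moreover have "indexed_pmult (\<lambda>m. if m = m0 then k else \<zero>\<^bsub>R\<^esub>) i
        = (\<lambda>m. if m = add_mset i m0 then k else \<zero>\<^bsub>R\<^esub>)"
      by (auto simp: defs fun_eq_iff)
    ultimately show ?case by simp
  qed
  have "f \<in> ?P" if "f \<in> polys R n" for f
    using that unfolding polys_def
  proof (induction rule: indexed_pset.induct)
    case (indexed_const k)
    have "finite {m. (if m = {#} then k else \<zero>\<^bsub>R\<^esub>) \<noteq> \<zero>\<^bsub>R\<^esub>}"
      by (rule finite_subset[of _ "{{#}}"]) auto
    with indexed_const show ?case by (auto simp: defs)
  next
    case (indexed_padd P Q)
    have "finite {m. P m \<oplus>\<^bsub>R\<^esub> Q m \<noteq> \<zero>\<^bsub>R\<^esub>}"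
      by (rule finite_subset[of _ "{m. P m \<noteq> \<zero>\<^bsub>R\<^esub>} \<union> {m. Q m \<noteq> \<zero>\<^bsub>R\<^esub>}"]) (use indexed_padd in auto)
    moreover have "set_mset m \<subseteq> {..<n}" if "P m \<oplus>\<^bsub>R\<^esub> Q m \<noteq> \<zero>\<^bsub>R\<^esub>" for m
    proof (rule ccontr)
      assume "\<not> set_mset m \<subseteq> {..<n}"
      then have "P m = \<zero>\<^bsub>R\<^esub>" "Q m = \<zero>\<^bsub>R\<^esub>" using indexed_padd by blast+
      with that show False by simp
    qed
    ultimately show ?case using indexed_padd.IH by (auto simp: defs image_subset_iff)
  next
    case (indexed_pmult P i)
    have "finite {m. (if i \<in># m then P (m - {#i#}) else \<zero>\<^bsub>R\<^esub>) \<noteq> \<zero>\<^bsub>R\<^esub>}"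
      by (rule finite_subset[of _ "add_mset i ` {m. P m \<noteq> \<zero>\<^bsub>R\<^esub>}"])
         (use indexed_pmult.IH in \<open>auto simp: image_iff split: if_splits dest: insert_DiffM[symmetric]\<close>)
    moreover have "set_mset m \<subseteq> {..<n}" if "i \<in># m" "P (m - {#i#}) \<noteq> \<zero>\<^bsub>R\<^esub>" for m
    proof -
      have "set_mset (m - {#i#}) \<subseteq> {..<n}" using indexed_pmult that by blast
      moreover have "set_mset m = insert i (set_mset (m - {#i#}))"
        using that(1) by (metis insert_DiffM set_mset_add_mset_insert)
      ultimately show ?thesis using indexed_pmult by auto
    qed
    ultimately show ?case using indexed_pmult.IH by (auto simp: defs image_subset_iff)
  qed
  moreover have "f \<in> polys R n" if "f \<in> ?P" for f
  proof -
    have "(\<lambda>m. if m \<in> T then f m else \<zero>\<^bsub>R\<^esub>) \<in> polys R n"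
      if "finite T" "T \<subseteq> {m. f m \<noteq> \<zero>\<^bsub>R\<^esub>}" for T
      using that
    proof (induction T)
      case empty
      show ?case using mono[of "{#}" "\<zero>\<^bsub>R\<^esub>"] by (simp cong: if_cong)
    next
      case (insert m0 T)
      have "indexed_padd (\<lambda>m. if m = m0 then f m0 else \<zero>\<^bsub>R\<^esub>) (\<lambda>m. if m \<in> T then f m else \<zero>\<^bsub>R\<^esub>)
          \<in> polys R n"
        unfolding polys_def
        by (rule indexed_pset.indexed_padd)
           (use mono[of m0 "f m0"] insert \<open>f \<in> ?P\<close> in \<open>auto simp: polys_def\<close>)
      moreover have "indexed_padd (\<lambda>m. if m = m0 then f m0 else \<zero>\<^bsub>R\<^esub>) (\<lambda>m. if m \<in> T then f m else \<zero>\<^bsub>R\<^esub>)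
          = (\<lambda>m. if m \<in> insert m0 T then f m else \<zero>\<^bsub>R\<^esub>)"
        using insert \<open>f \<in> ?P\<close> by (auto simp: defs fun_eq_iff image_subset_iff)
      ultimately show ?case by simp
    qed
    from this[of "{m. f m \<noteq> \<zero>\<^bsub>R\<^esub>}"] have "(\<lambda>m. if f m \<noteq> \<zero>\<^bsub>R\<^esub> then f m else \<zero>\<^bsub>R\<^esub>) \<in> polys R n"
      using \<open>f \<in> ?P\<close> by simp
    moreover have "(\<lambda>m. if f m \<noteq> \<zero>\<^bsub>R\<^esub> then f m else \<zero>\<^bsub>R\<^esub>) = f" by auto
    ultimately show ?thesis by simp
  qed
  ultimately show ?thesis by blast
qed

definition submonic_wrt ::
    "nat multiset rel \<Rightarrow> ('a, 'm) ring_scheme \<Rightarrow> (nat multiset \<Rightarrow> 'a) \<Rightarrow> bool" where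
  "submonic_wrt ord R f \<longleftrightarrow>
     (\<exists>t. f t \<noteq> \<zero>\<^bsub>R\<^esub> \<and> (\<forall>s. f s \<noteq> \<zero>\<^bsub>R\<^esub> \<longrightarrow> (t, s) \<in> ord) \<and> f t = \<one>\<^bsub>R\<^esub>)"

definition submonic :: "('a, 'm) ring_scheme \<Rightarrow> (nat multiset \<Rightarrow> 'a) \<Rightarrow> bool" where
  "submonic R f \<longleftrightarrow> (\<exists>ord. monomial_ordering ord \<and> submonic_wrt ord R f)"


section \<open>Algebraic dependence and transcendence degree\<close>

text \<open>
  An \<open>R\<close>-algebra is given by a ring \<open>A\<close> and its structure map \<open>h\<close>, i.e. by
  \<open>ring_hom_cring R A h\<close>.
\<close>

definition eval_poly ::
    "('a, 'm) ring_scheme \<Rightarrow> ('b, 'n) ring_scheme \<Rightarrow> ('a \<Rightarrow> 'b) \<Rightarrow> 'b list \<Rightarrow>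
      (nat multiset \<Rightarrow> 'a) \<Rightarrow> 'b" where
  "eval_poly R A h as f =
     (\<Oplus>\<^bsub>A\<^esub>m\<in>{m. f m \<noteq> \<zero>\<^bsub>R\<^esub>}. h (f m) \<otimes>\<^bsub>A\<^esub>
        (\<Otimes>\<^bsub>A\<^esub>i\<in>{..<length as}. (as ! i) [^]\<^bsub>A\<^esub> count m i))"

definition alg_dependent ::
    "('a, 'm) ring_scheme \<Rightarrow> ('b, 'n) ring_scheme \<Rightarrow> ('a \<Rightarrow> 'b) \<Rightarrow> 'b list \<Rightarrow> bool" where
  "alg_dependent R A h as \<longleftrightarrow>
     (\<exists>f \<in> polys R (length as). submonic R f \<and> eval_poly R A h as f = \<zero>\<^bsub>A\<^esub>)"

definition alg_dependent_wrt ::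
    "nat multiset rel \<Rightarrow> ('a, 'm) ring_scheme \<Rightarrow> ('b, 'n) ring_scheme \<Rightarrow> ('a \<Rightarrow> 'b) \<Rightarrow>
      'b list \<Rightarrow> bool" where
  "alg_dependent_wrt ord R A h as \<longleftrightarrow>
     (\<exists>f \<in> polys R (length as). submonic_wrt ord R f \<and> eval_poly R A h as f = \<zero>\<^bsub>A\<^esub>)"

definition trdeg_of :: "('b list \<Rightarrow> bool) \<Rightarrow> ('b, 'n) ring_scheme \<Rightarrow> ereal" where
  "trdeg_of dep A =
     (if \<forall>a \<in> carrier A. dep [a] then (if carrier A = {\<zero>\<^bsub>A\<^esub>} then -1 else 0)
      else Sup {ereal (real (length as)) | as.
                  0 < length as \<and> set as \<subseteq> carrier A \<and> \<not> dep as})"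

definition trdeg ::
    "('a, 'm) ring_scheme \<Rightarrow> ('b, 'n) ring_scheme \<Rightarrow> ('a \<Rightarrow> 'b) \<Rightarrow> ereal" where
  "trdeg R A h = trdeg_of (alg_dependent R A h) A"

definition trdeg_wrt ::
    "nat multiset rel \<Rightarrow> ('a, 'm) ring_scheme \<Rightarrow> ('b, 'n) ring_scheme \<Rightarrow> ('a \<Rightarrow> 'b) \<Rightarrow> ereal" where
  "trdeg_wrt ord R A h = trdeg_of (alg_dependent_wrt ord R A h) A"

abbreviation trdeg_self :: "('a, 'm) ring_scheme \<Rightarrow> ereal" where
  "trdeg_self R \<equiv> trdeg R R id"


section \<open>Krull dimension, Jacobson rings, finiteness conditions\<close>

text \<open>
  The zero ring gets dimension \<open>-1\<close>, in accordance with the convention for its transcendence degree.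
\<close>

definition krull_dim :: "('a, 'm) ring_scheme \<Rightarrow> ereal" where
  "krull_dim R =
     (if carrier R = {\<zero>\<^bsub>R\<^esub>} then -1
      else Sup {ereal (real n) | n. \<exists>P :: nat \<Rightarrow> 'a set.
                  (\<forall>i\<le>n. primeideal (P i) R) \<and> (\<forall>i<n. P i \<subset> P (Suc i))})"

definition jacobson_ring :: "('a, 'm) ring_scheme \<Rightarrow> bool" where
  "jacobson_ring R \<longleftrightarrow> cring R \<and>
     (\<forall>P. primeideal P R \<longrightarrow> (\<exists>\<M>. \<M> \<noteq> {} \<and> (\<forall>M\<in>\<M>. maximalideal M R) \<and> P = \<Inter>\<M>))"

definition fin_gen_algebra ::
    "('a, 'm) ring_scheme \<Rightarrow> ('b, 'n) ring_scheme \<Rightarrow> ('a \<Rightarrow> 'b) \<Rightarrow> bool" where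
  "fin_gen_algebra R A h \<longleftrightarrow> ring_hom_cring R A h \<and>
     (\<exists>E. finite E \<and> E \<subseteq> carrier A \<and> carrier A = generate_ring A (h ` carrier R \<union> E))"

text \<open>
  Being a subalgebra is expressed by an injective homomorphism of \<open>R\<close>-algebras into a finitely
  generated \<open>R\<close>-algebra \<open>B\<close>. The type of \<open>B\<close> is no restriction: a finitely generated \<open>R\<close>-algebra is
  isomorphic to a quotient of some \<open>R[x\<^sub>0, \<dots>, x\<^sub>n\<^sub>-\<^sub>1]\<close>, whose elements are sets of polynomials.
\<close>

definition subfinite_algebra ::
    "('a, 'm) ring_scheme \<Rightarrow> ('b, 'n) ring_scheme \<Rightarrow> ('a \<Rightarrow> 'b) \<Rightarrow> bool" where
  "subfinite_algebra R A h \<longleftrightarrow> ring_hom_cring R A h \<and>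
     (\<exists>(B :: (nat multiset \<Rightarrow> 'a) set ring) g \<iota>. fin_gen_algebra R B g \<and>
        \<iota> \<in> ring_hom A B \<and> inj_on \<iota> (carrier A) \<and> (\<forall>r \<in> carrier R. \<iota> (h r) = g r))"


section \<open>Localization\<close>

definition frac_rel :: "('a, 'm) ring_scheme \<Rightarrow> 'a set \<Rightarrow> ('a \<times> 'a) rel" where
  "frac_rel S M = {((a, s), (b, t)). a \<in> carrier S \<and> b \<in> carrier S \<and> s \<in> M \<and> t \<in> M \<and>
     (\<exists>u \<in> M. u \<otimes>\<^bsub>S\<^esub> (a \<otimes>\<^bsub>S\<^esub> t \<ominus>\<^bsub>S\<^esub> b \<otimes>\<^bsub>S\<^esub> s) = \<zero>\<^bsub>S\<^esub>)}"

definition fraction :: "('a, 'm) ring_scheme \<Rightarrow> 'a set \<Rightarrow> 'a \<Rightarrow> 'a \<Rightarrow> ('a \<times> 'a) set" where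
  "fraction S M a s = frac_rel S M `` {(a, s)}"

definition localization :: "('a, 'm) ring_scheme \<Rightarrow> 'a set \<Rightarrow> ('a \<times> 'a) set ring" where
  "localization S M =
     \<lparr> carrier = (carrier S \<times> M) // frac_rel S M,
       monoid.mult = (\<lambda>U V. \<Union>(a, s)\<in>U. \<Union>(b, t)\<in>V. fraction S M (a \<otimes>\<^bsub>S\<^esub> b) (s \<otimes>\<^bsub>S\<^esub> t)),
       one = fraction S M \<one>\<^bsub>S\<^esub> \<one>\<^bsub>S\<^esub>,
       ring.zero = fraction S M \<zero>\<^bsub>S\<^esub> \<one>\<^bsub>S\<^esub>,
       add = (\<lambda>U V. \<Union>(a, s)\<in>U. \<Union>(b, t)\<in>V.
                fraction S M (a \<otimes>\<^bsub>S\<^esub> t \<oplus>\<^bsub>S\<^esub> b \<otimes>\<^bsub>S\<^esub> s) (s \<otimes>\<^bsub>S\<^esub> t)) \<rparr>"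

definition adjoin_inverse :: "('a, 'm) ring_scheme \<Rightarrow> 'a \<Rightarrow> ('a \<times> 'a) set ring" where
  "adjoin_inverse S b = localization S (range (\<lambda>n :: nat. b [^]\<^bsub>S\<^esub> n))"

definition to_adjoin_inverse :: "('a, 'm) ring_scheme \<Rightarrow> 'a \<Rightarrow> 'a \<Rightarrow> ('a \<times> 'a) set" where
  "to_adjoin_inverse S b a = fraction S (range (\<lambda>n :: nat. b [^]\<^bsub>S\<^esub> n)) a \<one>\<^bsub>S\<^esub>"

definition quot_field :: "('a, 'm) ring_scheme \<Rightarrow> ('a \<times> 'a) set ring" where
  "quot_field S = localization S (carrier S - {\<zero>\<^bsub>S\<^esub>})"

definition to_quot_field :: "('a, 'm) ring_scheme \<Rightarrow> 'a \<Rightarrow> ('a \<times> 'a) set" where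
  "to_quot_field S a = fraction S (carrier S - {\<zero>\<^bsub>S\<^esub>}) a \<one>\<^bsub>S\<^esub>"

text \<open>Sanity checks: localization at a multiplicative set is a commutative ring, and the localization
  of a domain at its nonzero elements is a field.\<close>

locale localized = cring S + submonoid M S for S (structure) and M
begin

lemma M_carrier [simp]: "s \<in> M \<Longrightarrow> s \<in> carrier S"
  using subset by blast

lemma frac_rel_iff:
  "((a, s), (b, t)) \<in> frac_rel S M \<longleftrightarrow> a \<in> carrier S \<and> b \<in> carrier S \<and> s \<in> M \<and> t \<in> M \<and>
     (\<exists>u\<in>M. u \<otimes> (a \<otimes> t) = u \<otimes> (b \<otimes> s))"
proof -
  have "u \<otimes> (a \<otimes> t \<ominus> b \<otimes> s) = \<zero> \<longleftrightarrow> u \<otimes> (a \<otimes> t) = u \<otimes> (b \<otimes> s)"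
    if "a \<in> carrier S" "b \<in> carrier S" "s \<in> M" "t \<in> M" "u \<in> M" for u
  proof -
    have "u \<otimes> (a \<otimes> t \<ominus> b \<otimes> s) = u \<otimes> (a \<otimes> t) \<ominus> u \<otimes> (b \<otimes> s)"
      using that by (simp add: minus_eq r_distr r_minus)
    then show ?thesis using that by (simp add: r_right_minus_eq)
  qed
  then show ?thesis unfolding frac_rel_def by auto
qed

lemma equiv_frac_rel: "equiv (carrier S \<times> M) (frac_rel S M)"
proof (rule equivI)
  show "frac_rel S M \<subseteq> (carrier S \<times> M) \<times> (carrier S \<times> M)"
    by (auto simp: frac_rel_def)
  show "refl_on (carrier S \<times> M) (frac_rel S M)"
    by (rule refl_onI) (auto simp: frac_rel_iff)
  show "sym (frac_rel S M)"
    by (rule symI, clarsimp simp: frac_rel_iff) (metis)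
  show "trans (frac_rel S M)"
  proof (rule transI, clarsimp simp: frac_rel_iff)
    fix a s b t c w u v
    assume c: "a \<in> carrier S" "b \<in> carrier S" "c \<in> carrier S" "s \<in> M" "t \<in> M" "w \<in> M" "u \<in> M" "v \<in> M"
      and 1: "u \<otimes> (a \<otimes> t) = u \<otimes> (b \<otimes> s)" and 2: "v \<otimes> (b \<otimes> w) = v \<otimes> (c \<otimes> t)"
    have "(u \<otimes> v \<otimes> t) \<otimes> (a \<otimes> w) = (v \<otimes> w) \<otimes> (u \<otimes> (a \<otimes> t))" using c by (simp add: m_ac)
    also have "\<dots> = (u \<otimes> s) \<otimes> (v \<otimes> (b \<otimes> w))" unfolding 1 using c by (simp add: m_ac)
    also have "\<dots> = (u \<otimes> v \<otimes> t) \<otimes> (c \<otimes> s)" unfolding 2 using c by (simp add: m_ac)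
    finally show "\<exists>u\<in>M. u \<otimes> (a \<otimes> w) = u \<otimes> (c \<otimes> s)" using c by (meson m_closed)
  qed
qed

lemma fraction_in_carrier [simp, intro]:
  "a \<in> carrier S \<Longrightarrow> s \<in> M \<Longrightarrow> fraction S M a s \<in> carrier (localization S M)"
  by (auto simp: fraction_def localization_def intro: quotientI)

lemma carrier_localizationE:
  assumes "x \<in> carrier (localization S M)"
  obtains a s where "a \<in> carrier S" "s \<in> M" "x = fraction S M a s"
  using assms by (auto simp: fraction_def localization_def elim!: quotientE)

lemma fraction_eq_iff:
  assumes "a \<in> carrier S" "s \<in> M" "b \<in> carrier S" "t \<in> M"
  shows "fraction S M a s = fraction S M b t \<longleftrightarrow> (\<exists>u\<in>M. u \<otimes> (a \<otimes> t) = u \<otimes> (b \<otimes> s))"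
  using eq_equiv_class_iff[OF equiv_frac_rel, of "(a, s)" "(b, t)"] assms
  by (simp add: fraction_def frac_rel_iff)

lemma mult_fraction:
  assumes "a \<in> carrier S" "s \<in> M" "b \<in> carrier S" "t \<in> M"
  shows "fraction S M a s \<otimes>\<^bsub>localization S M\<^esub> fraction S M b t = fraction S M (a \<otimes> b) (s \<otimes> t)"
proof -
  have "congruent2 (frac_rel S M) (frac_rel S M)
      (\<lambda>p q. (case p of (a, s) \<Rightarrow> case q of (b, t) \<Rightarrow> fraction S M (a \<otimes> b) (s \<otimes> t)))"
  proof (rule congruent2I'; clarsimp simp: frac_rel_iff)
    fix a s a' s' b t b' t' u v
    assume c: "a \<in> carrier S" "a' \<in> carrier S" "s \<in> M" "s' \<in> M" "u \<in> M"
       "b \<in> carrier S" "b' \<in> carrier S" "t \<in> M" "t' \<in> M" "v \<in> M"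
      and 1: "u \<otimes> (a \<otimes> s') = u \<otimes> (a' \<otimes> s)" and 2: "v \<otimes> (b \<otimes> t') = v \<otimes> (b' \<otimes> t)"
    have "(u \<otimes> v) \<otimes> ((a \<otimes> b) \<otimes> (s' \<otimes> t')) = (u \<otimes> (a \<otimes> s')) \<otimes> (v \<otimes> (b \<otimes> t'))"
      using c by (simp add: m_ac)
    also have "\<dots> = (u \<otimes> v) \<otimes> ((a' \<otimes> b') \<otimes> (s \<otimes> t))" unfolding 1 2 using c by (simp add: m_ac)
    finally show "fraction S M (a \<otimes> b) (s \<otimes> t) = fraction S M (a' \<otimes> b') (s' \<otimes> t')"
      using c by (subst fraction_eq_iff) (auto intro!: bexI[of _ "u \<otimes> v"])
  qed
  from UN_equiv_class2[OF equiv_frac_rel equiv_frac_rel this, of "(a, s)" "(b, t)"] assms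
  show ?thesis by (simp add: localization_def fraction_def case_prod_beta)
qed

lemma add_fraction:
  assumes "a \<in> carrier S" "s \<in> M" "b \<in> carrier S" "t \<in> M"
  shows "fraction S M a s \<oplus>\<^bsub>localization S M\<^esub> fraction S M b t
       = fraction S M (a \<otimes> t \<oplus> b \<otimes> s) (s \<otimes> t)"
proof -
  have "congruent2 (frac_rel S M) (frac_rel S M)
      (\<lambda>p q. (case p of (a, s) \<Rightarrow> case q of (b, t) \<Rightarrow> fraction S M (a \<otimes> t \<oplus> b \<otimes> s) (s \<otimes> t)))"
  proof (rule congruent2I'; clarsimp simp: frac_rel_iff)
    fix a s a' s' b t b' t' u v
    assume c: "a \<in> carrier S" "a' \<in> carrier S" "s \<in> M" "s' \<in> M" "u \<in> M"
       "b \<in> carrier S" "b' \<in> carrier S" "t \<in> M" "t' \<in> M" "v \<in> M"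
      and 1: "u \<otimes> (a \<otimes> s') = u \<otimes> (a' \<otimes> s)" and 2: "v \<otimes> (b \<otimes> t') = v \<otimes> (b' \<otimes> t)"
    have "(u \<otimes> v) \<otimes> ((a \<otimes> t \<oplus> b \<otimes> s) \<otimes> (s' \<otimes> t'))
        = (u \<otimes> (a \<otimes> s')) \<otimes> (v \<otimes> (t \<otimes> t')) \<oplus> (v \<otimes> (b \<otimes> t')) \<otimes> (u \<otimes> (s \<otimes> s'))"
      using c by (simp add: m_ac l_distr r_distr)
    also have "\<dots> = (u \<otimes> v) \<otimes> ((a' \<otimes> t' \<oplus> b' \<otimes> s') \<otimes> (s \<otimes> t))"
      unfolding 1 2 using c by (simp add: m_ac l_distr r_distr)
    finally show "fraction S M (a \<otimes> t \<oplus> b \<otimes> s) (s \<otimes> t)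
        = fraction S M (a' \<otimes> t' \<oplus> b' \<otimes> s') (s' \<otimes> t')"
      using c by (subst fraction_eq_iff) (auto intro!: bexI[of _ "u \<otimes> v"])
  qed
  from UN_equiv_class2[OF equiv_frac_rel equiv_frac_rel this, of "(a, s)" "(b, t)"] assms
  show ?thesis by (simp add: localization_def fraction_def case_prod_beta)
qed

lemma one_localization: "\<one>\<^bsub>localization S M\<^esub> = fraction S M \<one> \<one>"
  and zero_localization: "\<zero>\<^bsub>localization S M\<^esub> = fraction S M \<zero> \<one>"
  by (simp_all add: localization_def)

lemma fraction_eqI:
  assumes "a \<otimes> t = b \<otimes> s" "a \<in> carrier S" "s \<in> M" "b \<in> carrier S" "t \<in> M"
  shows "fraction S M a s = fraction S M b t"
  using assms by (subst fraction_eq_iff) (auto intro!: bexI[of _ \<one>])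

lemma cring_localization: "cring (localization S M)"
proof (rule cringI)
  note ops = mult_fraction add_fraction one_localization zero_localization
  let ?L = "localization S M"
  have closed: "x \<otimes>\<^bsub>?L\<^esub> y \<in> carrier ?L" "x \<oplus>\<^bsub>?L\<^esub> y \<in> carrier ?L"
    if "x \<in> carrier ?L" "y \<in> carrier ?L" for x y
    using that by (elim carrier_localizationE; simp add: ops)+
  have comm: "x \<otimes>\<^bsub>?L\<^esub> y = y \<otimes>\<^bsub>?L\<^esub> x" "x \<oplus>\<^bsub>?L\<^esub> y = y \<oplus>\<^bsub>?L\<^esub> x"
    if "x \<in> carrier ?L" "y \<in> carrier ?L" for x y
    using that by (elim carrier_localizationE; simp add: ops m_comm a_comm)+
  have assoc: "x \<otimes>\<^bsub>?L\<^esub> y \<otimes>\<^bsub>?L\<^esub> z = x \<otimes>\<^bsub>?L\<^esub> (y \<otimes>\<^bsub>?L\<^esub> z)"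
    "x \<oplus>\<^bsub>?L\<^esub> y \<oplus>\<^bsub>?L\<^esub> z = x \<oplus>\<^bsub>?L\<^esub> (y \<oplus>\<^bsub>?L\<^esub> z)"
    "(x \<oplus>\<^bsub>?L\<^esub> y) \<otimes>\<^bsub>?L\<^esub> z = x \<otimes>\<^bsub>?L\<^esub> z \<oplus>\<^bsub>?L\<^esub> y \<otimes>\<^bsub>?L\<^esub> z"
    if xyz: "x \<in> carrier ?L" "y \<in> carrier ?L" "z \<in> carrier ?L" for x y z
  proof -
    obtain a s b t c w where c: "a \<in> carrier S" "s \<in> M" "b \<in> carrier S" "t \<in> M"
        "c \<in> carrier S" "w \<in> M"
      and eq: "x = fraction S M a s" "y = fraction S M b t" "z = fraction S M c w"
      using xyz by (metis carrier_localizationE)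
    show "x \<otimes>\<^bsub>?L\<^esub> y \<otimes>\<^bsub>?L\<^esub> z = x \<otimes>\<^bsub>?L\<^esub> (y \<otimes>\<^bsub>?L\<^esub> z)"
      unfolding eq using c by (simp add: ops m_assoc)
    show "x \<oplus>\<^bsub>?L\<^esub> y \<oplus>\<^bsub>?L\<^esub> z = x \<oplus>\<^bsub>?L\<^esub> (y \<oplus>\<^bsub>?L\<^esub> z)"
      unfolding eq using c by (simp add: ops m_ac a_ac l_distr r_distr)
    have "fraction S M ((a \<otimes> t \<oplus> b \<otimes> s) \<otimes> c) (s \<otimes> t \<otimes> w) =
        fraction S M (a \<otimes> c \<otimes> (t \<otimes> w) \<oplus> b \<otimes> c \<otimes> (s \<otimes> w)) (s \<otimes> w \<otimes> (t \<otimes> w))"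
      by (rule fraction_eqI) (use c in \<open>simp_all add: m_ac l_distr r_distr\<close>)
    then show "(x \<oplus>\<^bsub>?L\<^esub> y) \<otimes>\<^bsub>?L\<^esub> z = x \<otimes>\<^bsub>?L\<^esub> z \<oplus>\<^bsub>?L\<^esub> y \<otimes>\<^bsub>?L\<^esub> z"
      unfolding eq using c by (simp add: ops)
  qed
  show "(x \<oplus>\<^bsub>?L\<^esub> y) \<otimes>\<^bsub>?L\<^esub> z = x \<otimes>\<^bsub>?L\<^esub> z \<oplus>\<^bsub>?L\<^esub> y \<otimes>\<^bsub>?L\<^esub> z"
    if "x \<in> carrier ?L" "y \<in> carrier ?L" "z \<in> carrier ?L" for x y z
    using that by (rule assoc)
  have one: "\<one>\<^bsub>?L\<^esub> \<otimes>\<^bsub>?L\<^esub> x = x" and zero: "\<zero>\<^bsub>?L\<^esub> \<oplus>\<^bsub>?L\<^esub> x = x" if "x \<in> carrier ?L" for x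
    using that by (elim carrier_localizationE; simp add: ops)+
  have neg: "\<exists>y\<in>carrier ?L. y \<oplus>\<^bsub>?L\<^esub> x = \<zero>\<^bsub>?L\<^esub>" if x: "x \<in> carrier ?L" for x
  proof -
    obtain a s where as: "a \<in> carrier S" "s \<in> M" "x = fraction S M a s"
      using x by (rule carrier_localizationE)
    have "fraction S M \<zero> (s \<otimes> s) = fraction S M \<zero> \<one>"
      by (rule fraction_eqI) (use as in auto)
    then have "fraction S M (\<ominus> a) s \<oplus>\<^bsub>?L\<^esub> x = \<zero>\<^bsub>?L\<^esub>"
      using as by (simp add: ops l_minus l_neg)
    then show ?thesis using as by blast
  qed
  have units: "\<one>\<^bsub>?L\<^esub> \<in> carrier ?L" "\<zero>\<^bsub>?L\<^esub> \<in> carrier ?L"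
    unfolding one_localization zero_localization by auto
  show "abelian_group ?L"
    by (rule abelian_groupI) (assumption | rule closed assoc zero neg units comm)+
  show "comm_monoid ?L"
    by (rule comm_monoidI) (assumption | rule closed assoc one units comm)+
qed

lemma to_localization_hom: "(\<lambda>a. fraction S M a \<one>) \<in> ring_hom S (localization S M)"
  by (rule ring_hom_memI) (simp_all add: mult_fraction add_fraction one_localization)

end

lemma (in domain) localized_nonzero: "localized R (carrier R - {\<zero>})"
proof (intro localized.intro submonoid.intro)
  show "x \<otimes> y \<in> carrier R - {\<zero>}" if "x \<in> carrier R - {\<zero>}" "y \<in> carrier R - {\<zero>}" for x y
    using that integral[of x y] by blast
  show "cring R" by (rule is_cring)
  show "carrier R - {\<zero>} \<subseteq> carrier R" by blast
  show "\<one> \<in> carrier R - {\<zero>}" using one_not_zero by blast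
qed

lemma (in domain) field_quot_field: "field (quot_field R)"
proof -
  define M where "M = carrier R - {\<zero>}"
  interpret localized R M
    unfolding M_def by (rule localized_nonzero)
  have Q: "quot_field R = localization R M"
    by (simp add: quot_field_def M_def)
  interpret Q: cring "localization R M"
    by (rule cring_localization)
  have nz: "\<zero>\<^bsub>localization R M\<^esub> \<noteq> \<one>\<^bsub>localization R M\<^esub>"
  proof
    assume "\<zero>\<^bsub>localization R M\<^esub> = \<one>\<^bsub>localization R M\<^esub>"
    then have "fraction R M \<zero> \<one> = fraction R M \<one> \<one>"
      unfolding zero_localization one_localization .
    moreover have "\<one> \<in> M" by (simp add: M_def)
    ultimately have "\<exists>u\<in>M. u \<otimes> (\<zero> \<otimes> \<one>) = u \<otimes> (\<one> \<otimes> \<one>)"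
      by (subst (asm) fraction_eq_iff) simp_all
    then obtain u where u: "u \<in> M" "u \<otimes> (\<zero> \<otimes> \<one>) = u \<otimes> (\<one> \<otimes> \<one>)" by (rule bexE)
    then have "u \<in> carrier R" "u \<noteq> \<zero>" unfolding M_def by blast+
    with u(2) show False by simp
  qed
  have "x \<in> Units (localization R M)"
    if x: "x \<in> carrier (localization R M)" "x \<noteq> \<zero>\<^bsub>localization R M\<^esub>" for x
  proof -
    obtain a s where as: "a \<in> carrier R" "s \<in> M" "x = fraction R M a s"
      using x(1) by (rule carrier_localizationE)
    have "a \<noteq> \<zero>"
    proof
      assume "a = \<zero>"
      moreover have "fraction R M \<zero> s = fraction R M \<zero> \<one>"
        by (rule fraction_eqI) (simp_all add: as)
      ultimately show False using x as unfolding zero_localization by simp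
    qed
    then have a: "a \<in> M" using as(1) unfolding M_def by blast
    have s: "s \<in> carrier R" using as by simp
    have "fraction R M (s \<otimes> a) (a \<otimes> s) = fraction R M \<one> \<one>"
      by (rule fraction_eqI) (simp_all add: as a s m_comm)
    then have "fraction R M s a \<otimes>\<^bsub>localization R M\<^esub> x = \<one>\<^bsub>localization R M\<^esub>"
      using as a s by (simp add: one_localization mult_fraction)
    moreover have c: "fraction R M s a \<in> carrier (localization R M)"
      using s a by simp
    ultimately show ?thesis
      using x(1) Q.m_comm[OF x(1) c] unfolding Units_def by auto
  qed
  moreover have "\<zero>\<^bsub>localization R M\<^esub> \<notin> Units (localization R M)"
  proof
    assume "\<zero>\<^bsub>localization R M\<^esub> \<in> Units (localization R M)"
    then show False using Q.Units_l_inv_ex nz by (metis Q.r_null)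
  qed
  ultimately have "Units (localization R M) = carrier (localization R M) - {\<zero>\<^bsub>localization R M\<^esub>}"
    using Q.Units_closed by blast
  then show ?thesis unfolding Q by (rule Q.cring_fieldI)
qed

lemma (in cring) localized_powers:
  assumes "b \<in> carrier R"
  shows "localized R (range (\<lambda>n :: nat. b [^] n))"
proof -
  have "b [^] n \<otimes> b [^] m \<in> range (\<lambda>n :: nat. b [^] n)" for n m :: nat
    using assms by (auto simp: nat_pow_mult)
  moreover have "\<one> \<in> range (\<lambda>n :: nat. b [^] n)" by (rule range_eqI[of _ _ 0]) simp
  ultimately show ?thesis using assms by unfold_locales auto
qed

end

theory Submission
  imports Defs
begin

text \<open>
  (a) If the prime \<open>Q\<close> is not an intersection of maximal ideals, pick \<open>b \<notin> Q\<close> lying in every maximal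
  ideal above \<open>Q\<close>, and let \<open>P \<supseteq> Q\<close> be maximal among the ideals that avoid the powers of \<open>b\<close>. Then \<open>P\<close>
  is prime, it is not maximal as \<open>b \<notin> P\<close>, and every nonzero element of \<open>R/P\<close> divides a power of \<open>b\<close>,
  so inverting \<open>b\<close> gives a field. A submonic relation for a single element \<open>a\<close> reads
  \<open>a\<^sup>k (1 + a c) = 0\<close>; hence a nonzero nonunit of a domain is algebraically independent, and
  injective homomorphisms carry this over to the field.

  (b) The indeterminate is a nonzero nonunit of \<open>K[x]\<close>, so it is independent. Two rational functions
  \<open>p/q\<close> and \<open>r/q\<close> with \<open>p, q, r\<close> of degree at most \<open>d\<close> are dependent by counting: for \<open>i, j \<le> N\<close>
  the \<open>(N + 1)\<^sup>2\<close> polynomials \<open>p\<^sup>i r\<^sup>j q\<^sup>2\<^sup>N\<^sup>-\<^sup>i\<^sup>-\<^sup>j\<close> lie in a space of dimension \<open>2 N d + 1\<close>, which is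
  too small once \<open>N > 2 d\<close>. Over a field any nonzero relation can be scaled to be submonic with respect
  to any given monomial ordering.
\<close>

section \<open>Preliminaries on sums, powers and monomial orderings\<close>

lemma (in abelian_monoid) finsum_superset:
  assumes "finite T" "B \<subseteq> T" "\<And>m. m \<in> T \<Longrightarrow> f m \<in> carrier G" "\<And>m. m \<in> T - B \<Longrightarrow> f m = \<zero>"
  shows "(\<Oplus>m\<in>B. f m) = (\<Oplus>m\<in>T. f m)"
  using add.finprod_mono_neutral_cong_left[of T B f f] assms by auto

lemma (in domain) nat_pow_nonzero:
  assumes "a \<in> carrier R" "a \<noteq> \<zero>"
  shows "a [^] (n :: nat) \<noteq> \<zero>"
  using assms by (induction n) (simp_all add: integral_iff)

text \<open>Since 1 is at most \<open>t - s\<close>, multiplying by \<open>s\<close> shows that the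
  divisor \<open>s\<close> is at most \<open>t\<close>; antisymmetry leaves only equality. In one
  indeterminate this forces the trailing monomial to be the one of least exponent, whatever the
  ordering.\<close>

lemma monomial_ordering_le_imp_subset:
  assumes "monomial_ordering ord" "(t, s) \<in> ord" "s \<subseteq># t"
  shows "s = t"
proof -
  have "({#}, t - s) \<in> ord"
    using assms(1) unfolding monomial_ordering_def by blast
  then have "(s + {#}, s + (t - s)) \<in> ord"
    using assms(1) unfolding monomial_ordering_def by blast
  then have "(s, t) \<in> ord"
    using assms(3) by simp
  then show ?thesis
    using assms(1,2) unfolding monomial_ordering_def linear_order_on_def partial_order_on_def
    by (blast dest: antisymD)
qed

text \<open>Lets facts proved for one fixed ordering pass to \<open>alg_dependent\<close>.\<close>

lemma alg_dependent_iff: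
  "alg_dependent R A h as \<longleftrightarrow> (\<exists>ord. monomial_ordering ord \<and> alg_dependent_wrt ord R A h as)"
  unfolding alg_dependent_def alg_dependent_wrt_def submonic_def by blast

section \<open>Comparing transcendence degrees\<close>

lemma trdeg_of_mono:
  assumes "\<phi> ` carrier S \<subseteq> carrier A"
    and "\<And>as. set as \<subseteq> carrier S \<Longrightarrow> depA (map \<phi> as) \<Longrightarrow> depS as"
    and "carrier A = {\<zero>\<^bsub>A\<^esub>} \<Longrightarrow> carrier S = {\<zero>\<^bsub>S\<^esub>}"
  shows "trdeg_of depS S \<le> trdeg_of depA A"
proof -
  have S: "depS [a]" if "a \<in> carrier S" "depA [\<phi> a]" for a
    using assms(2)[of "[a]"] that by simp
  show ?thesis
  proof (cases "\<forall>a\<in>carrier A. depA [a]")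
    case True
    then have "\<forall>a\<in>carrier S. depS [a]"
      using S assms(1) by blast
    then show ?thesis
      using True assms(3) by (simp add: trdeg_of_def zero_ereal_def one_ereal_def)
  next
    case False
    then obtain a where a: "a \<in> carrier A" "\<not> depA [a]" by blast
    let ?X = "{ereal (real (length as)) |as. 0 < length as \<and> set as \<subseteq> carrier A \<and> \<not> depA as}"
    let ?Y = "{ereal (real (length as)) |as. 0 < length as \<and> set as \<subseteq> carrier S \<and> \<not> depS as}"
    have "ereal (real (length [a])) \<in> ?X"
      using a by (intro CollectI exI[of _ "[a]"]) simp
    then have "ereal (real (length [a])) \<le> Sup ?X"
      by (rule Sup_upper)
    \<comment> \<open>Handles the case where \<open>S\<close> takes one of the default values 0 or
      -1 while \<open>A\<close> has a genuine supremum.\<close>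
    then have 1: "0 \<le> Sup ?X" "-1 \<le> Sup ?X"
      by (auto simp: zero_ereal_def one_ereal_def elim: order_trans[rotated])
    have "?Y \<subseteq> ?X"
    proof
      fix y assume "y \<in> ?Y"
      then obtain as where as: "y = ereal (real (length as))" "0 < length as"
          "set as \<subseteq> carrier S" "\<not> depS as"
        by blast
      have "set (map \<phi> as) \<subseteq> carrier A" "\<not> depA (map \<phi> as)"
        using as assms(1,2) by auto
      then show "y \<in> ?X"
        using as(1,2) by (intro CollectI exI[of _ "map \<phi> as"]) simp
    qed
    then have "Sup ?Y \<le> Sup ?X"
      by (rule Sup_subset_mono)
    then show ?thesis
      unfolding trdeg_of_def if_not_P[OF False] using 1 by auto
  qed
qed

lemma trdeg_of_cong:
  assumes "\<And>as. set as \<subseteq> carrier A \<Longrightarrow> dep as \<longleftrightarrow> dep' as"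
  shows "trdeg_of dep A = trdeg_of dep' A"
  by (intro antisym trdeg_of_mono[where \<phi> = id]) (simp_all add: assms)

lemma trdeg_of_ge_1:
  assumes "a \<in> carrier A" "\<not> dep [a]"
  shows "1 \<le> trdeg_of dep A"
proof -
  have "ereal (real (length [a])) \<le>
      Sup {ereal (real (length as)) |as. 0 < length as \<and> set as \<subseteq> carrier A \<and> \<not> dep as}"
    using assms by (intro Sup_upper CollectI exI[of _ "[a]"]) simp
  then show ?thesis
    using assms by (auto simp: trdeg_of_def one_ereal_def)
qed

lemma trdeg_of_eq_1:
  assumes "a \<in> carrier A" "\<not> dep [a]"
    and "\<And>as. set as \<subseteq> carrier A \<Longrightarrow> 2 \<le> length as \<Longrightarrow> dep as"
  shows "trdeg_of dep A = 1"
proof (rule antisym)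
  have "length as \<le> 1" if "set as \<subseteq> carrier A" "\<not> dep as" for as
    using assms(3)[of as] that by force
  then show "trdeg_of dep A \<le> 1"
    using assms(1,2) by (auto simp: trdeg_of_def one_ereal_def intro!: Sup_least)
qed (rule trdeg_of_ge_1[of a], fact+)

text \<open>Dependence with respect to \<open>ord\<close> implies dependence, so admitting all
  orderings leaves fewer independent tuples.\<close>

lemma trdeg_le_trdeg_wrt:
  assumes "monomial_ordering ord"
  shows "trdeg R A h \<le> trdeg_wrt ord R A h"
  unfolding trdeg_def trdeg_wrt_def
proof (rule trdeg_of_mono[where \<phi> = id])
  show "alg_dependent R A h as" if "alg_dependent_wrt ord R A h (map id as)" for as
    using assms that unfolding alg_dependent_iff by auto
qed auto

section \<open>Evaluation of polynomials\<close>

context ring_hom_cring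
begin

lemma polysD:
  assumes "f \<in> polys R n"
  shows "f m \<in> carrier R" "finite {m. f m \<noteq> \<zero>\<^bsub>R\<^esub>}" "f m \<noteq> \<zero>\<^bsub>R\<^esub> \<Longrightarrow> set_mset m \<subseteq> {..<n}"
proof -
  have f: "range f \<subseteq> carrier R" "finite {m. f m \<noteq> \<zero>\<^bsub>R\<^esub>}"
      "\<forall>m. f m \<noteq> \<zero>\<^bsub>R\<^esub> \<longrightarrow> set_mset m \<subseteq> {..<n}"
    using assms unfolding polys_iff[OF R.ring_axioms] by blast+
  show "f m \<in> carrier R" "finite {m. f m \<noteq> \<zero>\<^bsub>R\<^esub>}"
    using f by blast+
  show "set_mset m \<subseteq> {..<n}" if "f m \<noteq> \<zero>\<^bsub>R\<^esub>"
    using f(3) that by blast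
qed

lemma eval_term_closed:
  assumes "r \<in> carrier R" "set as \<subseteq> carrier S"
  shows "h r \<otimes>\<^bsub>S\<^esub> (\<Otimes>\<^bsub>S\<^esub>i\<in>{..<length as}. (as ! i) [^]\<^bsub>S\<^esub> count m i) \<in> carrier S"
  using assms by (intro S.m_closed S.finprod_closed) (auto simp: subset_iff)

text \<open>Changing the coefficients can shrink the support, over which \<open>eval_poly\<close>
  sums; this allows sums over a common finite set of monomials.\<close>

lemma eval_poly_superset:
  assumes "\<And>m. f m \<in> carrier R" "set as \<subseteq> carrier S" "finite T" "{m. f m \<noteq> \<zero>\<^bsub>R\<^esub>} \<subseteq> T"
  shows "eval_poly R S h as f = (\<Oplus>\<^bsub>S\<^esub>m\<in>T. h (f m) \<otimes>\<^bsub>S\<^esub>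
           (\<Otimes>\<^bsub>S\<^esub>i\<in>{..<length as}. (as ! i) [^]\<^bsub>S\<^esub> count m i))"
  unfolding eval_poly_def
proof (rule S.finsum_superset)
  show "h (f m) \<otimes>\<^bsub>S\<^esub> (\<Otimes>\<^bsub>S\<^esub>i\<in>{..<length as}. (as ! i) [^]\<^bsub>S\<^esub> count m i) \<in> carrier S" for m
    using assms by (intro eval_term_closed) auto
  show "h (f m) \<otimes>\<^bsub>S\<^esub> (\<Otimes>\<^bsub>S\<^esub>i\<in>{..<length as}. (as ! i) [^]\<^bsub>S\<^esub> count m i) = \<zero>\<^bsub>S\<^esub>"
    if "m \<in> T - {m. f m \<noteq> \<zero>\<^bsub>R\<^esub>}" for m
    using that assms(2) by (auto simp: subset_iff intro!: S.l_null S.finprod_closed)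
qed (use assms in auto)

lemma hom_finprod:
  assumes "f \<in> B \<rightarrow> carrier R"
  shows "h (\<Otimes>\<^bsub>R\<^esub>i\<in>B. f i) = (\<Otimes>\<^bsub>S\<^esub>i\<in>B. h (f i))"
  using assms by (induction B rule: infinite_finite_induct) (auto simp: Pi_def)

lemma eval_poly_hom:
  assumes "ring_hom_cring K R k" "\<And>x. x \<in> carrier K \<Longrightarrow> k' x = h (k x)"
    and f: "f \<in> polys K n" and as: "set as \<subseteq> carrier R"
  shows "eval_poly K S k' (map h as) f = h (eval_poly K R k as f)"
proof -
  interpret k: ring_hom_cring K R k by fact
  note f = k.polysD[OF f]
  let ?T = "\<lambda>m. k (f m) \<otimes>\<^bsub>R\<^esub> (\<Otimes>\<^bsub>R\<^esub>i\<in>{..<length as}. (as ! i) [^]\<^bsub>R\<^esub> count m i)"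
  have nth: "as ! i \<in> carrier R" if "i < length as" for i
    using as nth_mem[OF that] by blast
  have T: "?T m \<in> carrier R" for m
    using f as by (intro k.eval_term_closed)
  have "h (?T m) = k' (f m) \<otimes>\<^bsub>S\<^esub> (\<Otimes>\<^bsub>S\<^esub>i\<in>{..<length as}. (map h as ! i) [^]\<^bsub>S\<^esub> count m i)" for m
  proof -
    have "h (\<Otimes>\<^bsub>R\<^esub>i\<in>{..<length as}. (as ! i) [^]\<^bsub>R\<^esub> count m i)
        = (\<Otimes>\<^bsub>S\<^esub>i\<in>{..<length as}. h ((as ! i) [^]\<^bsub>R\<^esub> count m i))"
      using nth by (intro hom_finprod) auto
    also have "\<dots> = (\<Otimes>\<^bsub>S\<^esub>i\<in>{..<length as}. (map h as ! i) [^]\<^bsub>S\<^esub> count m i)"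
      using nth by (intro S.finprod_cong') auto
    finally have 1: "h (\<Otimes>\<^bsub>R\<^esub>i\<in>{..<length as}. (as ! i) [^]\<^bsub>R\<^esub> count m i)
        = (\<Otimes>\<^bsub>S\<^esub>i\<in>{..<length as}. (map h as ! i) [^]\<^bsub>S\<^esub> count m i)" .
    have "(\<Otimes>\<^bsub>R\<^esub>i\<in>{..<length as}. (as ! i) [^]\<^bsub>R\<^esub> count m i) \<in> carrier R"
      using nth by (intro R.finprod_closed) auto
    then show ?thesis
      using f(1)[of m] assms(2) by (simp add: 1[symmetric])
  qed
  then show ?thesis
    unfolding eval_poly_def using T by (simp add: Pi_def comp_def)
qed

text \<open>Both sides quantify over the same polynomials, the value at \<open>map h as\<close> is
  the image under \<open>h\<close> of the value at \<open>as\<close>, and an injective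
  \<open>h\<close> detects its vanishing. The structure maps are compared on the carrier only, their
  values elsewhere being arbitrary.\<close>

lemma alg_dependent_wrt_inj_hom:
  assumes "ring_hom_cring K R k" "\<And>x. x \<in> carrier K \<Longrightarrow> k' x = h (k x)"
    and "inj_on h (carrier R)" and as: "set as \<subseteq> carrier R"
  shows "alg_dependent_wrt ord K S k' (map h as) \<longleftrightarrow> alg_dependent_wrt ord K R k as"
proof -
  interpret k: ring_hom_cring K R k by fact
  have "eval_poly K S k' (map h as) f = \<zero>\<^bsub>S\<^esub> \<longleftrightarrow> eval_poly K R k as f = \<zero>\<^bsub>R\<^esub>"
    if f: "f \<in> polys K n" for f n
  proof -
    have "eval_poly K R k as f \<in> carrier R"
      unfolding eval_poly_def using k.polysD[OF f] as
      by (intro R.finsum_closed) (auto intro!: k.eval_term_closed)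
    then show ?thesis
      using eval_poly_hom[OF assms(1,2) f as] assms(3) hom_zero
      by (metis R.zero_closed inj_on_eq_iff)
  qed
  then show ?thesis
    unfolding alg_dependent_wrt_def by auto
qed

lemma alg_dependent_inj_hom:
  assumes "ring_hom_cring K R k" "\<And>x. x \<in> carrier K \<Longrightarrow> k' x = h (k x)"
    and "inj_on h (carrier R)" "set as \<subseteq> carrier R"
  shows "alg_dependent K S k' (map h as) \<longleftrightarrow> alg_dependent K R k as"
  using alg_dependent_wrt_inj_hom[OF assms] unfolding alg_dependent_iff by blast

lemma trdeg_inj_hom_le:
  assumes "ring_hom_cring K R k" "\<And>x. x \<in> carrier K \<Longrightarrow> k' x = h (k x)"
    and "inj_on h (carrier R)"
  shows "trdeg K R k \<le> trdeg K S k'"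
  unfolding trdeg_def
proof (rule trdeg_of_mono[where \<phi> = h])
  show "h ` carrier R \<subseteq> carrier S" by auto
  show "carrier R = {\<zero>\<^bsub>R\<^esub>}" if "carrier S = {\<zero>\<^bsub>S\<^esub>}"
  proof -
    have "x = \<zero>\<^bsub>R\<^esub>" if "x \<in> carrier R" for x
      using that \<open>carrier S = _\<close> hom_closed[of x] hom_closed[of "\<zero>\<^bsub>R\<^esub>"] assms(3)
      by (metis R.zero_closed inj_onD singletonD)
    then show ?thesis by auto
  qed
qed (use alg_dependent_inj_hom[OF assms] in auto)

text \<open>Along a surjection of coefficient rings, a submonic polynomial stays submonic, and a lift that
  respects \<open>0\<close> and \<open>1\<close> of a submonic polynomial is submonic.\<close>

lemma alg_dependent_wrt_surj:
  assumes "ring_hom_cring S A g" "\<And>x. x \<in> carrier R \<Longrightarrow> k x = g (h x)"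
    and surj: "h ` carrier R = carrier S" and nz: "\<one>\<^bsub>S\<^esub> \<noteq> \<zero>\<^bsub>S\<^esub>"
    and as: "set as \<subseteq> carrier A"
  shows "alg_dependent_wrt ord R A k as \<longleftrightarrow> alg_dependent_wrt ord S A g as"
proof -
  interpret g: ring_hom_cring S A g by fact
  have "k \<in> ring_hom R A"
    by (rule ring_hom_memI) (simp_all add: assms(2))
  then interpret k: ring_hom_cring R A k
    by (intro ring_hom_cringI R.is_cring g.S.is_cring)
  note iff = polys_iff[OF R.ring_axioms] polys_iff[OF S.ring_axioms]
  have eval: "eval_poly S A g as (\<lambda>m. h (f m)) = eval_poly R A k as f"
    if f: "f \<in> polys R n" for f n
  proof -
    note f = polysD[OF f]
    have "eval_poly S A g as (\<lambda>m. h (f m)) = (\<Oplus>\<^bsub>A\<^esub>m\<in>{m. f m \<noteq> \<zero>\<^bsub>R\<^esub>}. g (h (f m)) \<otimes>\<^bsub>A\<^esub>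
           (\<Otimes>\<^bsub>A\<^esub>i\<in>{..<length as}. (as ! i) [^]\<^bsub>A\<^esub> count m i))"
      by (rule g.eval_poly_superset) (use f as in auto)
    also have "\<dots> = eval_poly R A k as f"
      using f assms(2) by (simp add: eval_poly_def)
    finally show ?thesis .
  qed
  show ?thesis
  proof
    assume "alg_dependent_wrt ord R A k as"
    then obtain f where f: "f \<in> polys R (length as)" "submonic_wrt ord R f"
        "eval_poly R A k as f = \<zero>\<^bsub>A\<^esub>"
      unfolding alg_dependent_wrt_def by blast
    have "finite {m. h (f m) \<noteq> \<zero>\<^bsub>S\<^esub>}"
      by (rule finite_subset[OF _ polysD(2)[OF f(1)]]) auto
    moreover have "set_mset m \<subseteq> {..<length as}" if "h (f m) \<noteq> \<zero>\<^bsub>S\<^esub>" for m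
      using that polysD(3)[OF f(1), of m] by fastforce
    ultimately have "(\<lambda>m. h (f m)) \<in> polys S (length as)"
      using polysD(1)[OF f(1)] by (auto simp: iff)
    \<comment> \<open>The support can only shrink under \<open>h\<close>, and the trailing monomial
      survives because 1 and 0 differ in \<open>S\<close>.\<close>
    moreover have "submonic_wrt ord S (\<lambda>m. h (f m))"
      using f(2) nz unfolding submonic_wrt_def by (metis hom_one hom_zero)
    ultimately show "alg_dependent_wrt ord S A g as"
      using eval[OF f(1)] f(3) unfolding alg_dependent_wrt_def by auto
  next
    assume "alg_dependent_wrt ord S A g as"
    then obtain f where f: "f \<in> polys S (length as)" "submonic_wrt ord S f"
        "eval_poly S A g as f = \<zero>\<^bsub>A\<^esub>"
      unfolding alg_dependent_wrt_def by blast
    \<comment> \<open>An arbitrary section of \<open>h\<close> could send 0 to a nonzero element of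
      the kernel, making the lift nonzero at infinitely many monomials, or could send 1 to another
      preimage, spoiling the trailing coefficient.\<close>
    define \<sigma> where "\<sigma> y = (if y = \<zero>\<^bsub>S\<^esub> then \<zero>\<^bsub>R\<^esub> else if y = \<one>\<^bsub>S\<^esub> then \<one>\<^bsub>R\<^esub> else
        inv_into (carrier R) h y)" for y
    have \<sigma>: "\<sigma> y \<in> carrier R" "h (\<sigma> y) = y" if "y \<in> carrier S" for y
      using that surj by (auto simp: \<sigma>_def inv_into_into f_inv_into_f)
    have \<sigma>0: "\<sigma> y = \<zero>\<^bsub>R\<^esub> \<longleftrightarrow> y = \<zero>\<^bsub>S\<^esub>" if "y \<in> carrier S" for y
      using \<sigma>[OF that] by (auto simp: \<sigma>_def)
    have fc: "f m \<in> carrier S" for m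
      using f(1) by (auto simp: iff)
    have lift: "(\<lambda>m. \<sigma> (f m)) \<in> polys R (length as)"
      using f(1) \<sigma>(1) \<sigma>0 fc by (auto simp: iff)
    moreover have "submonic_wrt ord R (\<lambda>m. \<sigma> (f m))"
      using f(2) nz \<sigma>0 fc unfolding submonic_wrt_def by (metis \<sigma>_def)
    moreover have "eval_poly R A k as (\<lambda>m. \<sigma> (f m)) = \<zero>\<^bsub>A\<^esub>"
      using eval[OF lift] f(3) fc \<sigma>(2) by simp
    ultimately show "alg_dependent_wrt ord R A k as"
      unfolding alg_dependent_wrt_def by blast
  qed
qed

lemma
  assumes "ring_hom_cring S A g" "\<And>x. x \<in> carrier R \<Longrightarrow> k x = g (h x)"
    and "h ` carrier R = carrier S" "\<one>\<^bsub>S\<^esub> \<noteq> \<zero>\<^bsub>S\<^esub>"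
  shows trdeg_wrt_surj: "trdeg_wrt ord R A k = trdeg_wrt ord S A g"
    and trdeg_surj: "trdeg R A k = trdeg S A g"
proof -
  show "trdeg_wrt ord R A k = trdeg_wrt ord S A g"
    unfolding trdeg_wrt_def by (intro trdeg_of_cong alg_dependent_wrt_surj[OF assms])
  show "trdeg R A k = trdeg S A g"
    unfolding trdeg_def alg_dependent_iff
    by (intro trdeg_of_cong) (simp add: alg_dependent_wrt_surj[OF assms])
qed

text \<open>For a single indeterminate all monomial orderings compare exponents, so the trailing
  term of a relation is \<open>a^k\<close> with the least exponent \<open>k\<close>. Cancelling
  \<open>a^k\<close> in the domain leaves \<open>1 + a c = 0\<close>, which makes \<open>-c\<close>
  an inverse of \<open>a\<close>.\<close>

lemma nonunit_alg_independent:
  assumes "domain S" and a: "a \<in> carrier S" "a \<noteq> \<zero>\<^bsub>S\<^esub>" "a \<notin> Units S"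
  shows "\<not> alg_dependent R S h [a]"
proof
  assume "alg_dependent R S h [a]"
  then obtain f where f: "f \<in> polys R 1" "eval_poly R S h [a] f = \<zero>\<^bsub>S\<^esub>" and sub: "submonic R f"
    unfolding alg_dependent_def by auto
  from sub obtain ord t where ord: "monomial_ordering ord"
    and t: "f t \<noteq> \<zero>\<^bsub>R\<^esub>" "\<And>s. f s \<noteq> \<zero>\<^bsub>R\<^esub> \<Longrightarrow> (t, s) \<in> ord" "f t = \<one>\<^bsub>R\<^esub>"
    unfolding submonic_def submonic_wrt_def by blast
  interpret S: "domain" S by fact
  note fD = polysD[OF f(1)]
  let ?M = "{m. f m \<noteq> \<zero>\<^bsub>R\<^esub>}"
  let ?k = "count t 0"
  \<comment> \<open>Only the index 0 occurs in \<open>m\<close>, so an exponent at most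
    \<open>?k\<close> would make \<open>m\<close> a divisor of \<open>t\<close>.\<close>
  have le: "?k < count m 0" if "m \<in> ?M - {t}" for m
  proof (rule ccontr)
    assume "\<not> ?k < count m 0"
    have "m \<subseteq># t"
    proof (unfold subseteq_mset_def, rule allI)
      fix i show "count m i \<le> count t i"
        using fD(3)[of m] that \<open>\<not> ?k < count m 0\<close> by (cases "i \<in># m") (auto simp: not_in_iff)
    qed
    then show False
      using monomial_ordering_le_imp_subset[OF ord t(2)] that by blast
  qed
  \<comment> \<open>The cofactor of \<open>a^(k+1)\<close> in the sum of the nontrailing terms; by
    \<open>le\<close> the truncated subtraction is exact.\<close>
  define c where "c = (\<Oplus>\<^bsub>S\<^esub>m\<in>?M - {t}. h (f m) \<otimes>\<^bsub>S\<^esub> a [^]\<^bsub>S\<^esub> (count m 0 - Suc ?k))"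
  have c: "c \<in> carrier S"
    unfolding c_def using fD(1) a by auto
  have "\<zero>\<^bsub>S\<^esub> = (\<Oplus>\<^bsub>S\<^esub>m\<in>?M. h (f m) \<otimes>\<^bsub>S\<^esub> a [^]\<^bsub>S\<^esub> count m 0)"
    using f(2) a fD(1) by (simp add: eval_poly_def lessThan_Suc)
  also have "\<dots> = (\<Oplus>\<^bsub>S\<^esub>m\<in>insert t (?M - {t}). h (f m) \<otimes>\<^bsub>S\<^esub> a [^]\<^bsub>S\<^esub> count m 0)"
    using t(1) by (simp add: insert_absorb)
  also have "\<dots> = a [^]\<^bsub>S\<^esub> ?k \<oplus>\<^bsub>S\<^esub> (\<Oplus>\<^bsub>S\<^esub>m\<in>?M - {t}. h (f m) \<otimes>\<^bsub>S\<^esub> a [^]\<^bsub>S\<^esub> count m 0)"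
    using fD(1,2) a t(3) by (subst S.finsum_insert) auto
  also have "(\<Oplus>\<^bsub>S\<^esub>m\<in>?M - {t}. h (f m) \<otimes>\<^bsub>S\<^esub> a [^]\<^bsub>S\<^esub> count m 0) =
     (\<Oplus>\<^bsub>S\<^esub>m\<in>?M - {t}. (a [^]\<^bsub>S\<^esub> ?k \<otimes>\<^bsub>S\<^esub> a) \<otimes>\<^bsub>S\<^esub> (h (f m) \<otimes>\<^bsub>S\<^esub> a [^]\<^bsub>S\<^esub> (count m 0 - Suc ?k)))"
  proof (rule S.finsum_cong')
    fix m assume m: "m \<in> ?M - {t}"
    then have "a [^]\<^bsub>S\<^esub> count m 0 = a [^]\<^bsub>S\<^esub> Suc ?k \<otimes>\<^bsub>S\<^esub> a [^]\<^bsub>S\<^esub> (count m 0 - Suc ?k)"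
      using le[OF m] S.nat_pow_mult[OF a(1), of "Suc ?k" "count m 0 - Suc ?k"]
      by (metis Suc_leI le_add_diff_inverse)
    then show "h (f m) \<otimes>\<^bsub>S\<^esub> a [^]\<^bsub>S\<^esub> count m 0 =
        (a [^]\<^bsub>S\<^esub> ?k \<otimes>\<^bsub>S\<^esub> a) \<otimes>\<^bsub>S\<^esub> (h (f m) \<otimes>\<^bsub>S\<^esub> a [^]\<^bsub>S\<^esub> (count m 0 - Suc ?k))"
      using a(1) fD(1) by (simp add: S.m_ac)
  qed (use fD(1) a in auto)
  also have "\<dots> = (a [^]\<^bsub>S\<^esub> ?k \<otimes>\<^bsub>S\<^esub> a) \<otimes>\<^bsub>S\<^esub> c"
    unfolding c_def using fD(1,2) a by (subst S.finsum_rdistr) auto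
  also have "a [^]\<^bsub>S\<^esub> ?k \<oplus>\<^bsub>S\<^esub> (a [^]\<^bsub>S\<^esub> ?k \<otimes>\<^bsub>S\<^esub> a) \<otimes>\<^bsub>S\<^esub> c = a [^]\<^bsub>S\<^esub> ?k \<otimes>\<^bsub>S\<^esub> (\<one>\<^bsub>S\<^esub> \<oplus>\<^bsub>S\<^esub> a \<otimes>\<^bsub>S\<^esub> c)"
    using a(1) c by (simp add: S.r_distr S.m_assoc)
  finally have "a [^]\<^bsub>S\<^esub> ?k \<otimes>\<^bsub>S\<^esub> (\<one>\<^bsub>S\<^esub> \<oplus>\<^bsub>S\<^esub> a \<otimes>\<^bsub>S\<^esub> c) = \<zero>\<^bsub>S\<^esub>"
    by (rule sym)
  moreover have "a [^]\<^bsub>S\<^esub> ?k \<noteq> \<zero>\<^bsub>S\<^esub>"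
    using a by (intro S.nat_pow_nonzero)
  ultimately have "\<one>\<^bsub>S\<^esub> \<oplus>\<^bsub>S\<^esub> a \<otimes>\<^bsub>S\<^esub> c = \<zero>\<^bsub>S\<^esub>"
    using a(1) c by (simp add: S.integral_iff)
  then have "\<one>\<^bsub>S\<^esub> = a \<otimes>\<^bsub>S\<^esub> (\<ominus>\<^bsub>S\<^esub> c)"
    using a c S.minus_equality[of "\<one>\<^bsub>S\<^esub>" "a \<otimes>\<^bsub>S\<^esub> c"] by (simp add: S.r_minus)
  then have "a \<in> Units S"
    using a(1) c S.m_comm unfolding Units_def by (intro CollectI conjI bexI[of _ "\<ominus>\<^bsub>S\<^esub> c"]) (auto simp: S.m_comm)
  with a(3) show False by simp
qed

end

section \<open>Fields and localizations\<close>

lemma (in field) krull_dim_eq_0: "krull_dim R = 0"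
proof -
  have prime: "P = {\<zero>}" if "primeideal P R" for P
    using primeideal.axioms(1)[OF that] primeideal.I_notcarr[OF that] all_ideals by blast
  have "(\<exists>P. (\<forall>i\<le>n. primeideal (P i) R) \<and> (\<forall>i<n. P i \<subset> P (Suc i))) \<longleftrightarrow> n = 0" for n :: nat
  proof
    assume "\<exists>P. (\<forall>i\<le>n. primeideal (P i) R) \<and> (\<forall>i<n. P i \<subset> P (Suc i))"
    then obtain P where P: "\<forall>i\<le>n. primeideal (P i) R" "\<forall>i<n. P i \<subset> P (Suc i)" by blast
    show "n = 0"
    proof (rule ccontr)
      assume "n \<noteq> 0"
      then have "P 0 = {\<zero>}" "P (Suc 0) = {\<zero>}" "P 0 \<subset> P (Suc 0)"
        using prime P by auto
      then show False by blast
    qed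
  next
    assume "n = 0"
    then show "\<exists>P. (\<forall>i\<le>n. primeideal (P i) R) \<and> (\<forall>i<n. P i \<subset> P (Suc i))"
      using zeroprimeideal by (intro exI[of _ "\<lambda>_. {\<zero>}"]) simp
  qed
  moreover have "carrier R \<noteq> {\<zero>}"
    using one_not_zero one_closed by blast
  ultimately show ?thesis
    by (simp add: krull_dim_def zero_ereal_def)
qed

lemma (in field) noetherian: "noetherian_ring R"
proof (rule noetherian_ringI)
  fix I assume "ideal I R"
  then consider "I = {\<zero>}" | "I = carrier R"
    using all_ideals by blast
  then show "\<exists>A\<subseteq>carrier R. finite A \<and> I = Idl A"
  proof cases
    case 1
    then show ?thesis
      using genideal_zero by (intro exI[of _ "{\<zero>}"]) auto
  next
    case 2
    then show ?thesis
      using genideal_one by (intro exI[of _ "{\<one>}"]) auto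
  qed
qed

context localized
begin

lemma to_localization_hom_cring:
  "ring_hom_cring S (localization S M) (\<lambda>a. fraction S M a \<one>)"
  by (intro ring_hom_cringI is_cring cring_localization to_localization_hom)

lemma inj_on_to_localization:
  assumes "domain S" "\<zero> \<notin> M"
  shows "inj_on (\<lambda>a. fraction S M a \<one>) (carrier S)"
proof (rule inj_onI)
  interpret "domain" S by fact
  fix a b assume ab: "a \<in> carrier S" "b \<in> carrier S" "fraction S M a \<one> = fraction S M b \<one>"
  then obtain u where u: "u \<in> M" "u \<otimes> (a \<otimes> \<one>) = u \<otimes> (b \<otimes> \<one>)"
    by (subst (asm) fraction_eq_iff) auto
  then have "u \<noteq> \<zero>"
    using assms(2) by blast
  then show "a = b"
    using u ab by (simp add: m_lcancel)
qed

text \<open>If \<open>a c\<close> lies in \<open>M\<close>, then \<open>a/s\<close> has the inverse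
  \<open>(c s)/(a c)\<close>. Hence it suffices that every nonzero element divides an element of
  \<open>M\<close>, which will be applied to the powers of a single \<open>b\<close>.\<close>

lemma field_localizationI:
  assumes "domain S" "\<zero> \<notin> M"
    and div: "\<And>a. a \<in> carrier S \<Longrightarrow> a \<noteq> \<zero> \<Longrightarrow> \<exists>c\<in>carrier S. a \<otimes> c \<in> M"
  shows "field (localization S M)"
proof -
  interpret "domain" S by fact
  interpret L: cring "localization S M" by (rule cring_localization)
  have nz: "\<one>\<^bsub>localization S M\<^esub> \<noteq> \<zero>\<^bsub>localization S M\<^esub>"
    using inj_onD[OF inj_on_to_localization[OF assms(1,2)], of \<one> \<zero>] one_not_zero
    by (auto simp: one_localization zero_localization)
  have unit: "x \<in> Units (localization S M)"
    if x: "x \<in> carrier (localization S M)" "x \<noteq> \<zero>\<^bsub>localization S M\<^esub>" for x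
  proof -
    obtain a s where a: "a \<in> carrier S" "s \<in> M" "x = fraction S M a s"
      using x(1) by (rule carrier_localizationE)
    have "a \<noteq> \<zero>"
    proof
      assume "a = \<zero>"
      then have "x = \<zero>\<^bsub>localization S M\<^esub>"
        unfolding zero_localization a(3) using a(1,2) by (intro fraction_eqI) auto
      then show False using x(2) by simp
    qed
    then obtain c where c: "c \<in> carrier S" "a \<otimes> c \<in> M"
      using div a(1) by blast
    let ?y = "fraction S M (c \<otimes> s) (a \<otimes> c)"
    have y: "?y \<in> carrier (localization S M)"
      using a c by auto
    have "x \<otimes>\<^bsub>localization S M\<^esub> ?y = fraction S M (a \<otimes> (c \<otimes> s)) (s \<otimes> (a \<otimes> c))"
      unfolding a(3) using a c by (intro mult_fraction) auto
    also have "\<dots> = \<one>\<^bsub>localization S M\<^esub>"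
      unfolding one_localization
    proof (rule fraction_eqI)
      show "a \<otimes> (c \<otimes> s) \<otimes> \<one> = \<one> \<otimes> (s \<otimes> (a \<otimes> c))"
        using a c by (simp add: m_ac)
    qed (use a c in auto)
    finally show ?thesis
      using x(1) y L.m_comm[OF x(1) y] unfolding Units_def by auto
  qed
  show ?thesis
  proof (rule L.cring_fieldI, intro equalityI subsetI DiffI)
    fix x assume x: "x \<in> Units (localization S M)"
    show "x \<in> carrier (localization S M)"
      using x by (rule L.Units_closed)
    show "x \<notin> {\<zero>\<^bsub>localization S M\<^esub>}"
    proof
      assume "x \<in> {\<zero>\<^bsub>localization S M\<^esub>}"
      then have "\<one>\<^bsub>localization S M\<^esub> = \<zero>\<^bsub>localization S M\<^esub>"
        using L.Units_r_inv_ex[OF x] by auto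
      then show False using nz by simp
    qed
  qed (use unit in blast)
qed

end

section \<open>Prime ideals maximal among those disjoint from a multiplicative set\<close>

text \<open>Zorn's lemma: the union of a nonempty chain of ideals avoiding \<open>M\<close> is again
  such an ideal. The choice \<open>M = {1}\<close> yields maximal ideals.\<close>

lemma (in cring) exists_maximal_disjoint_ideal:
  assumes "ideal I R" "I \<inter> M = {}"
  obtains P where "ideal P R" "I \<subseteq> P" "P \<inter> M = {}"
    "\<And>J. ideal J R \<Longrightarrow> P \<subseteq> J \<Longrightarrow> J \<inter> M = {} \<Longrightarrow> J = P"
proof -
  let ?A = "{J. ideal J R \<and> I \<subseteq> J \<and> J \<inter> M = {}}"
  have "\<exists>P\<in>?A. \<forall>J\<in>?A. P \<subseteq> J \<longrightarrow> J = P"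
  proof (rule subset_Zorn_nonempty)
    show "?A \<noteq> {}" using assms by blast
    fix C assume C: "C \<noteq> {}" "subset.chain ?A C"
    then have "subset.chain {J. ideal J R} C"
      unfolding subset.chain_def by blast
    then have "ideal (\<Union>C) R"
      using chain_Union_is_ideal[of C] C(1) by simp
    moreover have "C \<subseteq> ?A"
      using C(2) unfolding subset.chain_def by blast
    ultimately show "\<Union>C \<in> ?A"
      using C(1) by blast
  qed
  then obtain P where "P \<in> ?A" "\<forall>J\<in>?A. P \<subseteq> J \<longrightarrow> J = P" ..
  then show thesis
    by (intro that[of P]) auto
qed

locale maximal_disjoint_ideal = cring R + ideal P R + submonoid M R
  for R (structure) and P and M +
  assumes disjoint: "P \<inter> M = {}"
    and maximal: "\<And>J. ideal J R \<Longrightarrow> P \<subseteq> J \<Longrightarrow> J \<inter> M = {} \<Longrightarrow> J = P"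
begin

text \<open>The ideal \<open>P + (a)\<close> is strictly larger than \<open>P\<close>, so by
  maximality it meets \<open>M\<close>. This gives both the primality of \<open>P\<close> and the
  divisibility used for inverting elements of \<open>R/P\<close>.\<close>

lemma multiple_meets:
  assumes "a \<in> carrier R" "a \<notin> P"
  obtains p r m where "p \<in> P" "r \<in> carrier R" "m \<in> M" "m = p \<oplus> r \<otimes> a"
proof -
  let ?J = "P <+>\<^bsub>R\<^esub> PIdl a"
  have J: "?J = {y. \<exists>p\<in>P. \<exists>r\<in>carrier R. y = p \<oplus> r \<otimes> a}"
    unfolding set_add_def' cgenideal_def by blast
  have "ideal ?J R"
    using add_ideals[OF is_ideal cgenideal_ideal[OF assms(1)]] .
  moreover have "P \<subseteq> ?J"
  proof
    fix p assume "p \<in> P"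
    moreover have "p = p \<oplus> \<zero> \<otimes> a"
      using \<open>p \<in> P\<close> assms(1) Icarr by simp
    ultimately show "p \<in> ?J"
      unfolding J by blast
  qed
  moreover have "a = \<zero> \<oplus> \<one> \<otimes> a"
    using assms(1) by simp
  then have "a \<in> ?J"
    unfolding J using zero_closed one_closed additive_subgroup.zero_closed[OF is_additive_subgroup]
    by blast
  ultimately have "?J \<inter> M \<noteq> {}"
    using maximal[of ?J] assms(2) by blast
  then show thesis
    using that unfolding J by blast
qed

text \<open>If neither factor lies in \<open>P\<close>, there are \<open>p + r a\<close> and
  \<open>q + s b\<close> in \<open>M\<close>. Their product lies in \<open>M\<close> and is
  congruent to \<open>r s a b\<close> modulo \<open>P\<close>, so \<open>a b\<close> in
  \<open>P\<close> contradicts disjointness.\<close>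

lemma prime: "primeideal P R"
proof (rule primeidealI)
  show "carrier R \<noteq> P"
    using disjoint submonoid.one_closed[OF submonoid_axioms] by blast
  fix a b assume ab: "a \<in> carrier R" "b \<in> carrier R" "a \<otimes> b \<in> P"
  show "a \<in> P \<or> b \<in> P"
  proof (rule ccontr)
    assume "\<not> (a \<in> P \<or> b \<in> P)"
    then obtain p r m q s n where
      m: "p \<in> P" "r \<in> carrier R" "m \<in> M" "m = p \<oplus> r \<otimes> a" and
      n: "q \<in> P" "s \<in> carrier R" "n \<in> M" "n = q \<oplus> s \<otimes> b"
      using multiple_meets[OF ab(1)] multiple_meets[OF ab(2)] by metis
    have pq: "p \<in> carrier R" "q \<in> carrier R"
      using m n Icarr by auto
    have "m \<otimes> n = p \<otimes> n \<oplus> (r \<otimes> a \<otimes> q \<oplus> (r \<otimes> s) \<otimes> (a \<otimes> b))"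
      unfolding m(4) n(4) using m(2) n(2) pq ab by (simp add: l_distr r_distr m_ac a_ac)
    also have "\<dots> \<in> P"
    proof (intro a_closed)
      show "p \<otimes> n \<in> P"
        using m(1) n(3) by (intro I_r_closed) auto
      show "r \<otimes> a \<otimes> q \<in> P" "(r \<otimes> s) \<otimes> (a \<otimes> b) \<in> P"
        using m(2) n(1,2) ab by (simp_all add: I_l_closed)
    qed
    finally show False
      using disjoint submonoid.m_closed[OF submonoid_axioms m(3) n(3)] by blast
  qed
qed (fact is_ideal is_cring)+

end

lemma (in cring) exists_maximal_ideal:
  assumes "ideal I R" "\<one> \<notin> I"
  obtains P where "maximalideal P R" "I \<subseteq> P"
proof -
  obtain P where P: "ideal P R" "I \<subseteq> P" "P \<inter> {\<one>} = {}"
    "\<And>J. ideal J R \<Longrightarrow> P \<subseteq> J \<Longrightarrow> J \<inter> {\<one>} = {} \<Longrightarrow> J = P"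
    using exists_maximal_disjoint_ideal[OF assms(1), of "{\<one>}"] assms(2) by blast
  have "maximalideal P R"
  proof (rule maximalidealI[OF P(1)])
    show "J = P \<or> J = carrier R" if "ideal J R" "P \<subseteq> J" for J
      using P(4)[OF that] ideal.one_imp_carrier[OF that(1)] by blast
  qed (use P(3) in blast)
  with P(2) show thesis
    using that by blast
qed

lemma (in ideal) rcos_eq_zero_iff:
  assumes "r \<in> carrier R"
  shows "I +> r = \<zero>\<^bsub>R Quot I\<^esub> \<longleftrightarrow> r \<in> I"
  using a_rcos_self[OF assms] a_rcos_const[of r] by (auto simp: FactRing_def)

lemma not_jacobson_imp:
  fixes R (structure)
  assumes "cring R" "\<not> jacobson_ring R"
  obtains P b where "primeideal P R" "\<not> maximalideal P R"
    "b \<in> carrier (R Quot P)" "b \<noteq> \<zero>\<^bsub>R Quot P\<^esub>" "field (adjoin_inverse (R Quot P) b)"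
proof -
  interpret cring R by fact
  obtain Q where Q: "primeideal Q R" "\<And>\<M>. \<M> \<noteq> {} \<Longrightarrow> \<forall>M\<in>\<M>. maximalideal M R \<Longrightarrow> Q \<noteq> \<Inter>\<M>"
    using assms unfolding jacobson_ring_def by blast
  interpret Q: primeideal Q R by fact
  have "\<one> \<notin> Q"
    using Q.I_notcarr Q.one_imp_carrier by blast
  let ?\<M> = "{M. maximalideal M R \<and> Q \<subseteq> M}"
  \<comment> \<open>\<open>jacobson_ring\<close> asks for a nonempty family of maximal ideals. A
    member also places \<open>b\<close> in the carrier of \<open>R\<close>.\<close>
  obtain M0 where M0: "M0 \<in> ?\<M>"
    using exists_maximal_ideal[OF Q.is_ideal \<open>\<one> \<notin> Q\<close>] by blast
  then have "Q \<noteq> \<Inter>?\<M>"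
    by (intro Q(2)) auto
  moreover have "Q \<subseteq> \<Inter>?\<M>" by blast
  ultimately obtain b where b': "b \<in> \<Inter>?\<M>" and "b \<notin> Q" by blast
  have b: "b \<in> M" if "maximalideal M R" "Q \<subseteq> M" for M
    using b' that by blast
  have bR: "b \<in> carrier R"
  proof -
    interpret M0: maximalideal M0 R using M0 by simp
    show ?thesis using b[of M0] M0 M0.Icarr by simp
  qed
  let ?M = "range (\<lambda>n :: nat. b [^] n)"
  interpret M: localized R ?M
    by (rule localized_powers[OF bR])
  have "b [^] n \<notin> Q" for n :: nat
  proof (induction n)
    case (Suc n)
    then show ?case
      using \<open>b \<notin> Q\<close> bR Q.I_prime[of "b [^] n" b] by auto
  qed (simp add: \<open>\<one> \<notin> Q\<close>)
  then obtain P where P: "ideal P R" "Q \<subseteq> P" "P \<inter> ?M = {}"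
    "\<And>J. ideal J R \<Longrightarrow> P \<subseteq> J \<Longrightarrow> J \<inter> ?M = {} \<Longrightarrow> J = P"
    using exists_maximal_disjoint_ideal[OF Q.is_ideal, of ?M] by blast
  interpret P: maximal_disjoint_ideal R P ?M
    by (intro maximal_disjoint_ideal.intro maximal_disjoint_ideal_axioms.intro is_cring P
        M.submonoid_axioms)
  interpret P': primeideal P R by (rule P.prime)
  interpret S: "domain" "R Quot P" by (rule P'.quotient_is_domain)
  interpret \<pi>: ring_hom_cring R "R Quot P" "\<lambda>r. P +> r"
    by (rule P'.rcos_ring_hom_cring)
  have ker: "P +> r = \<zero>\<^bsub>R Quot P\<^esub> \<longleftrightarrow> r \<in> P" if "r \<in> carrier R" for r
    using that by (rule P.rcos_eq_zero_iff)
  have "b \<notin> P"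
    using P(3) bR by (metis Int_iff empty_iff nat_pow_eone rangeI)
  then have b': "P +> b \<noteq> \<zero>\<^bsub>R Quot P\<^esub>"
    using ker bR by blast
  show thesis
  proof (rule that[OF P.prime _ _ b'])
    \<comment> \<open>A maximal ideal above \<open>Q\<close> contains \<open>b\<close>, but
      \<open>P\<close> avoids the powers of \<open>b\<close>.\<close>
    show "\<not> maximalideal P R"
      using b P(2) \<open>b \<notin> P\<close> by blast
    show "P +> b \<in> carrier (R Quot P)"
      using bR by simp
    let ?N = "range (\<lambda>n :: nat. (P +> b) [^]\<^bsub>R Quot P\<^esub> n)"
    interpret N: localized "R Quot P" ?N
      using bR by (intro S.localized_powers) simp
    have "field (localization (R Quot P) ?N)"
    proof (rule N.field_localizationI[OF S.domain_axioms])
      show "\<zero>\<^bsub>R Quot P\<^esub> \<notin> ?N"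
        using S.nat_pow_nonzero[OF _ b'] bR by auto
      fix x assume x: "x \<in> carrier (R Quot P)" "x \<noteq> \<zero>\<^bsub>R Quot P\<^esub>"
      then obtain a where a: "a \<in> carrier R" "x = P +> a"
        unfolding FactRing_def A_RCOSETS_def' by auto
      then obtain p r m where m: "p \<in> P" "r \<in> carrier R" "m \<in> ?M" "m = p \<oplus> r \<otimes> a"
        using P.multiple_meets[of a] x ker by blast
      from m(3) obtain n :: nat where n: "m = b [^] n" by blast
      \<comment> \<open>Modulo \<open>P\<close> the power \<open>m = p + r a\<close> of
        \<open>b\<close> becomes \<open>r a\<close>, so the class of \<open>a\<close> divides a
        power of the class of \<open>b\<close>.\<close>
      have "(P +> b) [^]\<^bsub>R Quot P\<^esub> n = P +> m"
        using n bR by simp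
      also have "\<dots> = (P +> p) \<oplus>\<^bsub>R Quot P\<^esub> (P +> r) \<otimes>\<^bsub>R Quot P\<^esub> (P +> a)"
        using m a P.Icarr by simp
      also have "P +> p = \<zero>\<^bsub>R Quot P\<^esub>"
        using m ker P.Icarr by blast
      finally have "x \<otimes>\<^bsub>R Quot P\<^esub> (P +> r) = (P +> b) [^]\<^bsub>R Quot P\<^esub> n"
        using m a by (simp add: S.m_comm)
      then show "\<exists>c\<in>carrier (R Quot P). x \<otimes>\<^bsub>R Quot P\<^esub> c \<in> ?N"
        using m(2) by (intro bexI[of _ "P +> r"]) auto
    qed
    then show "field (adjoin_inverse (R Quot P) (P +> b))"
      by (simp add: adjoin_inverse_def)
  qed
qed

section \<open>Adjoining an inverse\<close>

text \<open>The single generator \<open>1/b\<close> suffices: each element is \<open>\<pi> r\<close>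
  times a power of \<open>1/b\<close>, as \<open>\<pi>\<close> is onto.\<close>

lemma fin_gen_adjoin_inverse:
  assumes "ring_hom_cring R S \<pi>" "\<pi> ` carrier R = carrier S" "b \<in> carrier S"
  shows "fin_gen_algebra R (adjoin_inverse S b) (\<lambda>r. to_adjoin_inverse S b (\<pi> r))"
proof -
  interpret \<pi>: ring_hom_cring R S \<pi> by fact
  let ?M = "range (\<lambda>n :: nat. b [^]\<^bsub>S\<^esub> n)"
  let ?A = "localization S ?M" and ?h = "\<lambda>r. fraction S ?M (\<pi> r) \<one>\<^bsub>S\<^esub>"
  interpret M: localized S ?M by (rule \<pi>.S.localized_powers[OF assms(3)])
  interpret A: ring_hom_cring S ?A "\<lambda>a. fraction S ?M a \<one>\<^bsub>S\<^esub>"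
    by (rule M.to_localization_hom_cring)
  have "?h \<in> ring_hom R ?A"
    by (rule ring_hom_memI) (simp_all)
  then have hom: "ring_hom_cring R ?A ?h"
    by (intro ring_hom_cringI \<pi>.R.is_cring A.S.is_cring)
  have bM: "b [^]\<^bsub>S\<^esub> n \<in> ?M" for n :: nat by simp
  have bM1: "b \<in> ?M"
    using bM[of 1] assms(3) by simp
  let ?E = "{fraction S ?M \<one>\<^bsub>S\<^esub> b}"
  let ?G = "generate_ring ?A (?h ` carrier R \<union> ?E)"
  have sub: "?h ` carrier R \<union> ?E \<subseteq> carrier ?A"
    using bM1 by auto
  have gen: "fraction S ?M (\<pi> r) (b [^]\<^bsub>S\<^esub> n) \<in> ?G" if r: "r \<in> carrier R" for r and n :: nat
  proof (induction n)
    case 0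
    then show ?case
      using r by (auto intro: generate_ring.incl)
  next
    case (Suc n)
    have "fraction S ?M (\<pi> r) (b [^]\<^bsub>S\<^esub> n) \<otimes>\<^bsub>?A\<^esub> fraction S ?M \<one>\<^bsub>S\<^esub> b \<in> ?G"
      using Suc by (intro generate_ring.eng_mult) (auto intro: generate_ring.incl)
    also have "fraction S ?M (\<pi> r) (b [^]\<^bsub>S\<^esub> n) \<otimes>\<^bsub>?A\<^esub> fraction S ?M \<one>\<^bsub>S\<^esub> b =
        fraction S ?M (\<pi> r) (b [^]\<^bsub>S\<^esub> Suc n)"
      using r bM1 bM[of n] by (subst M.mult_fraction) auto
    finally show ?case .
  qed
  have "carrier ?A \<subseteq> ?G"
  proof
    fix x assume "x \<in> carrier ?A"
    then obtain a s where a: "a \<in> carrier S" "s \<in> ?M" "x = fraction S ?M a s"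
      by (rule M.carrier_localizationE)
    from a(1) obtain r where r: "r \<in> carrier R" "a = \<pi> r"
      unfolding assms(2)[symmetric] by (rule imageE)
    from a(2) obtain n :: nat where "s = b [^]\<^bsub>S\<^esub> n"
      by (rule rangeE)
    then show "x \<in> ?G"
      using gen[OF r(1)] r(2) a(3) by simp
  qed
  then have "carrier ?A = ?G"
    using A.S.generate_ring_incl[OF sub] by blast
  then have "fin_gen_algebra R ?A ?h"
    unfolding fin_gen_algebra_def using hom sub by (intro conjI exI[of _ ?E]) auto
  then show ?thesis
    unfolding adjoin_inverse_def to_adjoin_inverse_def .
qed

text \<open>Images of generators generate the image. This serves to carry an algebra over to another
  carrier type.\<close>

lemma fin_gen_algebra_image:
  assumes "fin_gen_algebra R A h" "ring_hom_cring A B \<phi>" "\<phi> ` carrier A = carrier B"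
  shows "fin_gen_algebra R B (\<lambda>r. \<phi> (h r))"
proof -
  interpret h: ring_hom_cring R A h
    using assms(1) unfolding fin_gen_algebra_def by blast
  interpret \<phi>: ring_hom_cring A B \<phi> by fact
  obtain E where E: "finite E" "E \<subseteq> carrier A" "carrier A = generate_ring A (h ` carrier R \<union> E)"
    using assms(1) unfolding fin_gen_algebra_def by blast
  have "(\<lambda>r. \<phi> (h r)) \<in> ring_hom R B"
    by (rule ring_hom_memI) simp_all
  then have hom: "ring_hom_cring R B (\<lambda>r. \<phi> (h r))"
    by (intro ring_hom_cringI h.R.is_cring \<phi>.S.is_cring)
  let ?H = "h ` carrier R \<union> E" and ?H' = "(\<lambda>r. \<phi> (h r)) ` carrier R \<union> \<phi> ` E"
  have H: "?H \<subseteq> carrier A" "?H' \<subseteq> carrier B"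
    using E(2) by auto
  have "\<phi> x \<in> generate_ring B ?H'" if "x \<in> generate_ring A ?H" for x
    using that
  proof (induction rule: generate_ring.induct)
    case one
    show ?case
      unfolding \<phi>.hom_one by (rule generate_ring.one)
  next
    case (incl x)
    then have "\<phi> x \<in> ?H'" by auto
    then show ?case by (rule generate_ring.incl)
  next
    case (a_inv x)
    then have "x \<in> carrier A"
      using h.S.generate_ring_in_carrier[OF H(1)] by blast
    then show ?case
      using generate_ring.a_inv[OF a_inv.IH] by simp
  next
    case (eng_add x y)
    then have "x \<in> carrier A" "y \<in> carrier A"
      using h.S.generate_ring_in_carrier[OF H(1)] by blast+
    then show ?case
      using generate_ring.eng_add[OF eng_add.IH] by simp
  next
    case (eng_mult x y)
    then have "x \<in> carrier A" "y \<in> carrier A"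
      using h.S.generate_ring_in_carrier[OF H(1)] by blast+
    then show ?case
      using generate_ring.eng_mult[OF eng_mult.IH] by simp
  qed
  then have "\<phi> ` generate_ring A ?H \<subseteq> generate_ring B ?H'" by blast
  then have "carrier B \<subseteq> generate_ring B ?H'"
    unfolding E(3)[symmetric] assms(3) .
  then have "carrier B = generate_ring B ?H'"
    using \<phi>.S.generate_ring_incl[OF H(2)] by blast
  then show ?thesis
    unfolding fin_gen_algebra_def using hom E(1) H(2)
    by (intro conjI exI[of _ "\<phi> ` E"]) auto
qed

section \<open>Linear relations and transcendence degree over a field\<close>

text \<open>Gaussian elimination by induction on the number \<open>n\<close> of coordinates: unless
  the last coordinate vanishes on all vectors, one vector with a nonzero last coordinate is used to
  clear it in the others, and the induction hypothesis applies to these.\<close>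

lemma (in field) exists_linear_relation:
  fixes v :: "'i \<Rightarrow> nat \<Rightarrow> 'a"
  assumes "finite I" "n < card I" "\<And>i k. i \<in> I \<Longrightarrow> k < n \<Longrightarrow> v i k \<in> carrier R"
  obtains c where "\<And>i. i \<in> I \<Longrightarrow> c i \<in> carrier R" "\<exists>i\<in>I. c i \<noteq> \<zero>"
    "\<And>k. k < n \<Longrightarrow> (\<Oplus>i\<in>I. c i \<otimes> v i k) = \<zero>"
proof -
  have "\<exists>c. (\<forall>i\<in>I. c i \<in> carrier R) \<and> (\<exists>i\<in>I. c i \<noteq> \<zero>) \<and> (\<forall>k<n. (\<Oplus>i\<in>I. c i \<otimes> v i k) = \<zero>)"
    using assms
  proof (induction n arbitrary: I v)
    case 0
    then have "I \<noteq> {}" by auto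
    then show ?case
      by (intro exI[of _ "\<lambda>_. \<one>"]) auto
  next
    case (Suc n)
    note v = Suc.prems(3)
    show ?case
    proof (cases "\<forall>i\<in>I. v i n = \<zero>")
      case True
      obtain c where c: "\<forall>i\<in>I. c i \<in> carrier R" "\<exists>i\<in>I. c i \<noteq> \<zero>"
          "\<forall>k<n. (\<Oplus>i\<in>I. c i \<otimes> v i k) = \<zero>"
        using Suc.IH[of I v] Suc.prems by auto
      have "(\<Oplus>i\<in>I. c i \<otimes> v i n) = (\<Oplus>i\<in>I. \<zero>)"
        using True c(1) by (intro finsum_cong') auto
      then have "\<forall>k<Suc n. (\<Oplus>i\<in>I. c i \<otimes> v i k) = \<zero>"
        using c(3) by (simp add: less_Suc_eq)
      with c(1,2) show ?thesis by blast
    next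
      case False
      then obtain j where j: "j \<in> I" "v j n \<noteq> \<zero>" by blast
      define J where "J = I - {j}"
      have J: "finite J" "j \<notin> J" "I = insert j J"
        using Suc.prems(1) j(1) by (auto simp: J_def)
      have vj: "v j n \<in> carrier R" "v j n \<in> Units R"
        using v[of j n] j by (simp_all add: field_Units)
      \<comment> \<open>The multiple of the pivot vector \<open>v j\<close> whose subtraction kills
        coordinate \<open>n\<close> of \<open>v i\<close>.\<close>
      define \<mu> where "\<mu> i = v i n \<otimes> inv (v j n)" for i
      define w where "w i k = v i k \<ominus> \<mu> i \<otimes> v j k" for i k
      have \<mu>: "\<mu> i \<in> carrier R" if "i \<in> J" for i
        using v[of i n] that vj by (simp add: \<mu>_def J(3))
      have w: "w i k \<in> carrier R" if "i \<in> J" "k < Suc n" for i k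
        using v[of i k] v[of j k] \<mu>[OF that(1)] that by (simp add: w_def J(3))
      have wn: "w i n = \<zero>" if "i \<in> J" for i
        using v[of i n] vj that by (simp add: w_def \<mu>_def J(3) m_assoc r_right_minus_eq)
      have "n < card J"
        using Suc.prems(2) J by simp
      then obtain c where c: "\<forall>i\<in>J. c i \<in> carrier R" "\<exists>i\<in>J. c i \<noteq> \<zero>"
          "\<forall>k<n. (\<Oplus>i\<in>J. c i \<otimes> w i k) = \<zero>"
        using Suc.IH[of J w] J(1) w by auto
      have cw: "(\<Oplus>i\<in>J. c i \<otimes> w i k) = \<zero>" if "k < Suc n" for k
      proof (cases "k = n")
        case True
        have "(\<Oplus>i\<in>J. c i \<otimes> w i k) = (\<Oplus>i\<in>J. \<zero>)"
          using wn c(1) True by (intro finsum_cong') auto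
        then show ?thesis by simp
      qed (use c(3) that in simp)
      define s where "s = (\<Oplus>i\<in>J. c i \<otimes> \<mu> i)"
      have s: "s \<in> carrier R"
        unfolding s_def using c(1) \<mu> by (intro finsum_closed) auto
      \<comment> \<open>Expanding each \<open>w i\<close> as \<open>v i\<close> minus
        \<open>\<mu> i\<close> times \<open>v j\<close> in the relation among the \<open>w i\<close>
        gives \<open>v j\<close> the coefficient \<open>\<ominus> s\<close>.\<close>
      define c' where "c' i = (if i = j then \<ominus> s else c i)" for i
      have "(\<Oplus>i\<in>I. c' i \<otimes> v i k) = \<zero>" if k: "k < Suc n" for k
      proof -
        have vk: "v i k \<in> carrier R" if "i \<in> I" for i
          using v that k by blast
        have vjk: "v j k \<in> carrier R"
          using vk j(1) by blast
        have "(\<Oplus>i\<in>J. c' i \<otimes> v i k) = (\<Oplus>i\<in>J. c i \<otimes> w i k \<oplus> (c i \<otimes> \<mu> i) \<otimes> v j k)"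
        proof (rule finsum_cong')
          fix i assume i: "i \<in> J"
          have ci: "c i \<in> carrier R" "v i k \<in> carrier R" "\<mu> i \<in> carrier R"
            using c(1) i vk J \<mu> by auto
          have "c i \<otimes> w i k \<oplus> (c i \<otimes> \<mu> i) \<otimes> v j k = c i \<otimes> ((v i k \<ominus> \<mu> i \<otimes> v j k) \<oplus> \<mu> i \<otimes> v j k)"
            using ci vjk by (simp add: w_def r_distr m_assoc)
          also have "(v i k \<ominus> \<mu> i \<otimes> v j k) \<oplus> \<mu> i \<otimes> v j k = v i k"
            using ci vjk by (simp add: minus_eq a_assoc l_neg)
          finally show "c' i \<otimes> v i k = c i \<otimes> w i k \<oplus> (c i \<otimes> \<mu> i) \<otimes> v j k"
            using i J(2) by (auto simp: c'_def)
        qed (use c(1) w[OF _ k] \<mu> vjk in auto)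
        also have "\<dots> = (\<Oplus>i\<in>J. c i \<otimes> w i k) \<oplus> (\<Oplus>i\<in>J. (c i \<otimes> \<mu> i) \<otimes> v j k)"
          using c(1) w[OF _ k] \<mu> vjk by (intro finsum_addf) auto
        also have "\<dots> = s \<otimes> v j k"
          unfolding cw[OF k] s_def using c(1) \<mu> vjk J(1) by (subst finsum_ldistr) auto
        finally have "(\<Oplus>i\<in>J. c' i \<otimes> v i k) = s \<otimes> v j k" .
        moreover have "(\<Oplus>i\<in>I. c' i \<otimes> v i k) = c' j \<otimes> v j k \<oplus> (\<Oplus>i\<in>J. c' i \<otimes> v i k)"
          unfolding J(3) using J c(1) s vk by (intro finsum_insert) (auto simp: c'_def)
        moreover have "c' j \<otimes> v j k = \<ominus> (s \<otimes> v j k)"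
          using s vjk by (simp add: c'_def l_minus)
        ultimately show ?thesis
          using s vjk by (simp add: l_neg)
      qed
      moreover have "\<forall>i\<in>I. c' i \<in> carrier R"
        using c(1) s J by (auto simp: c'_def)
      moreover have "\<exists>i\<in>I. c' i \<noteq> \<zero>"
        using c(2) J by (auto simp: c'_def)
      ultimately show ?thesis by blast
    qed
  qed
  with that show thesis by blast
qed

lemma linear_order_finite_least:
  assumes "linear_order r" "finite T" "T \<noteq> {}"
  obtains t where "t \<in> T" "\<And>s. s \<in> T \<Longrightarrow> (t, s) \<in> r"
proof -
  have r: "trans r" "refl r" "total r"
    using assms(1) by (auto simp: linear_order_on_def partial_order_on_def preorder_on_def)
  have "\<exists>t\<in>T. \<forall>s\<in>T. (t, s) \<in> r"
    using assms(2,3)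
  proof (induction T rule: finite_ne_induct)
    case (singleton x)
    then show ?case using r(2) by (auto dest: refl_onD)
  next
    case (insert x T)
    then obtain t where t: "t \<in> T" "\<forall>s\<in>T. (t, s) \<in> r" by blast
    consider "(x, t) \<in> r" | "(t, x) \<in> r"
      using r(2,3) by (metis UNIV_I refl_onD total_on_def)
    then show ?case
    proof cases
      case 1
      then have "\<forall>s\<in>insert x T. (x, s) \<in> r"
        using t r(1,2) by (auto dest: refl_onD transD)
      then show ?thesis by blast
    next
      case 2
      with t show ?thesis by blast
    qed
  qed
  with that show thesis by blast
qed

text \<open>The trailing coefficient with respect to \<open>ord\<close> is a unit; dividing by it
  keeps the support and the vanishing, and makes the relation submonic. The monomial
  \<open>u\<close> witnesses that \<open>f\<close> is nonzero.\<close>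

lemma (in ring_hom_cring) alg_dependent_wrt_fieldI:
  assumes "field R" "monomial_ordering ord" and as: "set as \<subseteq> carrier S"
    and f: "f \<in> polys R (length as)" "f u \<noteq> \<zero>\<^bsub>R\<^esub>" "eval_poly R S h as f = \<zero>\<^bsub>S\<^esub>"
  shows "alg_dependent_wrt ord R S h as"
proof -
  interpret R: field R by fact
  note fD = polysD[OF f(1)]
  let ?T = "{m. f m \<noteq> \<zero>\<^bsub>R\<^esub>}"
  obtain t where t: "t \<in> ?T" "\<And>s. s \<in> ?T \<Longrightarrow> (t, s) \<in> ord"
    using linear_order_finite_least[of ord ?T] assms(2) fD(2) f(2)
    unfolding monomial_ordering_def by blast
  then have ft: "f t \<in> Units R"
    using fD(1) by (simp add: R.field_Units)
  let ?k = "inv\<^bsub>R\<^esub> f t"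
  have k: "?k \<in> carrier R"
    using ft by simp
  let ?f = "\<lambda>m. ?k \<otimes>\<^bsub>R\<^esub> f m"
  have sub: "{m. ?f m \<noteq> \<zero>\<^bsub>R\<^esub>} \<subseteq> ?T"
    using k by auto
  have "?f \<in> polys R (length as)"
    unfolding polys_iff[OF R.ring_axioms] using fD k finite_subset[OF sub fD(2)] sub by blast
  moreover have "submonic_wrt ord R ?f"
    unfolding submonic_wrt_def using t sub ft by (intro exI[of _ t]) auto
  moreover have "eval_poly R S h as ?f = \<zero>\<^bsub>S\<^esub>"
  proof -
    let ?e = "\<lambda>m. \<Otimes>\<^bsub>S\<^esub>i\<in>{..<length as}. (as ! i) [^]\<^bsub>S\<^esub> count m i"
    have e: "?e m \<in> carrier S" for m
      using as by (intro S.finprod_closed) (auto simp: subset_iff)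
    have "eval_poly R S h as ?f = (\<Oplus>\<^bsub>S\<^esub>m\<in>?T. h (?f m) \<otimes>\<^bsub>S\<^esub> ?e m)"
      using as fD k sub by (intro eval_poly_superset) auto
    also have "\<dots> = (\<Oplus>\<^bsub>S\<^esub>m\<in>?T. h ?k \<otimes>\<^bsub>S\<^esub> (h (f m) \<otimes>\<^bsub>S\<^esub> ?e m))"
      using fD(1) k e by (intro S.finsum_cong') (auto simp: S.m_assoc)
    also have "\<dots> = h ?k \<otimes>\<^bsub>S\<^esub> eval_poly R S h as f"
      unfolding eval_poly_def using fD(1,2) k e by (subst S.finsum_rdistr) auto
    also have "\<dots> = \<zero>\<^bsub>S\<^esub>"
      using f(3) k by simp
    finally show ?thesis .
  qed
  ultimately show ?thesis
    unfolding alg_dependent_wrt_def by blast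
qed

section \<open>Rational functions in one variable\<close>

text \<open>The exponents are recovered by \<open>count\<close>, so these monomials are distinct.
  Their number is the number of unknown coefficients in the counting argument.\<close>

lemma card_bivariate_monomials:
  "card ((\<lambda>(i, j). replicate_mset i 0 + replicate_mset j (1 :: nat)) ` ({..N} \<times> {..N})) = Suc N * Suc N"
proof -
  have "inj_on (\<lambda>(i, j). replicate_mset i 0 + replicate_mset j (1 :: nat)) ({..N} \<times> {..N})"
  proof (rule inj_onI, clarify)
    fix i j k l :: nat
    assume eq: "replicate_mset i 0 + replicate_mset j (1 :: nat) = replicate_mset k 0 + replicate_mset l 1"
    from arg_cong[OF eq, of "\<lambda>m. count m 0"] arg_cong[OF eq, of "\<lambda>m. count m 1"]
    show "i = k \<and> j = l" by simp
  qed
  then show ?thesis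
    by (simp add: card_image)
qed

context domain
begin

lemma to_quot_field_hom_cring: "ring_hom_cring R (quot_field R) (to_quot_field R)"
  and inj_on_to_quot_field: "inj_on (to_quot_field R) (carrier R)"
proof -
  interpret L: localized R "carrier R - {\<zero>}"
    by (rule localized_nonzero)
  show "ring_hom_cring R (quot_field R) (to_quot_field R)"
    unfolding quot_field_def to_quot_field_def by (rule L.to_localization_hom_cring)
  show "inj_on (to_quot_field R) (carrier R)"
    unfolding to_quot_field_def by (rule L.inj_on_to_localization[OF domain_axioms]) simp
qed

text \<open>The equation \<open>a = p/q\<close> in the form \<open>a q = p\<close>, ready for
  clearing denominators.\<close>

lemma quot_fieldE:
  assumes "a \<in> carrier (quot_field R)"
  obtains p q where "p \<in> carrier R" "q \<in> carrier R" "q \<noteq> \<zero>"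
    "a \<otimes>\<^bsub>quot_field R\<^esub> to_quot_field R q = to_quot_field R p"
proof -
  let ?M = "carrier R - {\<zero>}"
  interpret L: localized R ?M
    by (rule localized_nonzero)
  note [simp del] = L.M_carrier \<comment> \<open>loops when \<open>M\<close> is a set difference with the carrier\<close>
  obtain p q where pq: "p \<in> carrier R" "q \<in> ?M" "a = fraction R ?M p q"
    by (rule L.carrier_localizationE[OF assms[unfolded quot_field_def]])
  then have "fraction R ?M p q \<otimes>\<^bsub>localization R ?M\<^esub> fraction R ?M q \<one> = fraction R ?M (p \<otimes> q) q"
    using L.mult_fraction[of p q q \<one>] by simp
  also have "\<dots> = fraction R ?M p \<one>"
    using pq(1,2) by (intro L.fraction_eqI) auto
  finally show thesis
    using that[of p q] pq by (simp add: quot_field_def to_quot_field_def)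
qed

end

context UP_domain
begin

lemma deg_pow_le:
  assumes "p \<in> carrier P"
  shows "deg R (p [^]\<^bsub>P\<^esub> (n :: nat)) \<le> n * deg R p"
proof (induction n)
  case (Suc n)
  have "deg R (p [^]\<^bsub>P\<^esub> Suc n) \<le> deg R (p [^]\<^bsub>P\<^esub> n) + deg R p"
    using assms by (simp add: deg_mult_ring)
  with Suc show ?case by simp
qed simp

text \<open>Degrees add in a product of nonzero polynomials over a domain, so a multiple of the
  indeterminate is never of degree 0 unless it is zero.\<close>

lemma indeterminate_nonunit:
  "up_ring.monom P \<one> 1 \<noteq> \<zero>\<^bsub>P\<^esub>" "up_ring.monom P \<one> 1 \<notin> Units P"
proof -
  show nz: "up_ring.monom P \<one> 1 \<noteq> \<zero>\<^bsub>P\<^esub>"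
    using deg_monom[of \<one> 1] by (metis R.one_closed R.one_not_zero deg_zero zero_neq_one)
  show "up_ring.monom P \<one> 1 \<notin> Units P"
  proof
    assume "up_ring.monom P \<one> 1 \<in> Units P"
    then obtain y where y: "y \<in> carrier P" "up_ring.monom P \<one> 1 \<otimes>\<^bsub>P\<^esub> y = \<one>\<^bsub>P\<^esub>"
      using P.Units_r_inv_ex by blast
    then have "y \<noteq> \<zero>\<^bsub>P\<^esub>"
      by auto
    then have "deg R (up_ring.monom P \<one> 1) + deg R y = 0"
      using y nz deg_mult[of "up_ring.monom P \<one> 1" y] by simp
    then show False by simp
  qed
qed

abbreviation const_frac :: "'a \<Rightarrow> ((nat \<Rightarrow> 'a) \<times> (nat \<Rightarrow> 'a)) set" where
  "const_frac k \<equiv> to_quot_field P (up_ring.monom P k 0)"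

lemma const_frac_hom_cring: "ring_hom_cring R (quot_field P) const_frac"
proof -
  interpret q: ring_hom_cring P "quot_field P" "to_quot_field P"
    by (rule domain.to_quot_field_hom_cring[OF UP_domain])
  have "const_frac \<in> ring_hom R (quot_field P)"
    by (rule ring_hom_memI) (simp_all add: monom_mult[of _ _ 0 0, simplified])
  then show ?thesis
    by (intro ring_hom_cringI R.is_cring q.S.is_cring)
qed

text \<open>A relation between the first two entries, found by counting, is also a relation for the
  whole tuple; it is then scaled to suit \<open>ord\<close>.\<close>

lemma alg_dependent_quot_field:
  assumes "field R" "monomial_ordering ord"
    and as: "set as \<subseteq> carrier (quot_field P)" "2 \<le> length as"
  shows "alg_dependent_wrt ord R (quot_field P) const_frac as"
proof -
  let ?A = "quot_field P" and ?q = "to_quot_field P"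
  interpret R: field R by fact
  interpret A: field ?A by (rule domain.field_quot_field[OF UP_domain])
  interpret q: ring_hom_cring P ?A ?q by (rule domain.to_quot_field_hom_cring[OF UP_domain])
  interpret g: ring_hom_cring R ?A const_frac by (rule const_frac_hom_cring)
  have nth: "as ! i \<in> carrier ?A" if "i < length as" for i
    using as(1) nth_mem[OF that] by blast
  have a: "as ! 0 \<in> carrier ?A" "as ! 1 \<in> carrier ?A"
    using as(2) by (auto intro!: nth)
  obtain p0 q0 where 0: "p0 \<in> carrier P" "q0 \<in> carrier P" "q0 \<noteq> \<zero>\<^bsub>P\<^esub>" "as ! 0 \<otimes>\<^bsub>?A\<^esub> ?q q0 = ?q p0"
    using domain.quot_fieldE[OF UP_domain a(1)] by blast
  obtain p1 q1 where 1: "p1 \<in> carrier P" "q1 \<in> carrier P" "q1 \<noteq> \<zero>\<^bsub>P\<^esub>" "as ! 1 \<otimes>\<^bsub>?A\<^esub> ?q q1 = ?q p1"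
    using domain.quot_fieldE[OF UP_domain a(2)] by blast
  \<comment> \<open>A common denominator: the first two entries become \<open>p/Q\<close> and
    \<open>r/Q\<close>.\<close>
  define Q where "Q = q0 \<otimes>\<^bsub>P\<^esub> q1"
  define p where "p = p0 \<otimes>\<^bsub>P\<^esub> q1"
  define r where "r = p1 \<otimes>\<^bsub>P\<^esub> q0"
  have c: "Q \<in> carrier P" "p \<in> carrier P" "r \<in> carrier P" and Q: "Q \<noteq> \<zero>\<^bsub>P\<^esub>"
    using 0 1 by (auto simp: Q_def p_def r_def domain.integral_iff[OF UP_domain])
  have aQ: "as ! 0 \<otimes>\<^bsub>?A\<^esub> ?q Q = ?q p"
    using 0 1 a by (simp add: Q_def p_def A.m_assoc[symmetric])
  have "as ! 1 \<otimes>\<^bsub>?A\<^esub> ?q Q = (as ! 1 \<otimes>\<^bsub>?A\<^esub> ?q q1) \<otimes>\<^bsub>?A\<^esub> ?q q0"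
    using 0 1 a by (simp add: Q_def A.m_ac)
  then have bQ: "as ! 1 \<otimes>\<^bsub>?A\<^esub> ?q Q = ?q r"
    using 0 1 a by (simp add: r_def)
  define d where "d = Max {deg R p, deg R r, deg R Q}"
  have d: "deg R p \<le> d" "deg R r \<le> d" "deg R Q \<le> d"
    by (simp_all add: d_def)
  \<comment> \<open>Since \<open>N > 2 d\<close>, the number \<open>(N+1)^2\<close> of monomials
    exceeds \<open>2 N d + 1\<close>, the number of coefficients of a polynomial of degree at most
    \<open>2 N d\<close>.\<close>
  define N where "N = 2 * d + 1"
  define I where "I = (\<lambda>(i, j). replicate_mset i 0 + replicate_mset j (1 :: nat)) ` ({..N} \<times> {..N})"
  have fin: "finite I" by (simp add: I_def)
  have I: "count m 0 \<le> N" "count m 1 \<le> N" "set_mset m \<subseteq> {0, 1}" if "m \<in> I" for m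
    using that by (auto simp: I_def split: if_splits)
  \<comment> \<open>The value of the monomial \<open>m\<close> at \<open>p/Q\<close> and
    \<open>r/Q\<close>, multiplied by \<open>Q^(2N)\<close>. Both exponents are at most
    \<open>N\<close> for \<open>m\<close> in \<open>I\<close>, so the differences are exact.\<close>
  define V where "V m = p [^]\<^bsub>P\<^esub> count m 0 \<otimes>\<^bsub>P\<^esub> r [^]\<^bsub>P\<^esub> count m 1 \<otimes>\<^bsub>P\<^esub>
      Q [^]\<^bsub>P\<^esub> (N - count m 0 + (N - count m 1))" for m :: "nat multiset"
  have V: "V m \<in> carrier P" for m
    using c by (simp add: V_def)
  have degV: "deg R (V m) \<le> 2 * N * d" if "m \<in> I" for m
  proof -
    let ?i = "count m 0" and ?j = "count m 1"
    have "deg R (V m) \<le> deg R (p [^]\<^bsub>P\<^esub> ?i) + deg R (r [^]\<^bsub>P\<^esub> ?j) + deg R (Q [^]\<^bsub>P\<^esub> (N - ?i + (N - ?j)))"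
      unfolding V_def using c
      by (meson P.m_closed P.nat_pow_closed add_le_mono1 deg_mult_ring le_trans)
    also have "\<dots> \<le> ?i * d + ?j * d + (N - ?i + (N - ?j)) * d"
      using c d by (intro add_mono order_trans[OF deg_pow_le] mult_left_mono) auto
    also have "\<dots> = (?i + ?j + (N - ?i + (N - ?j))) * d"
      by (simp add: add_mult_distrib)
    also have "?i + ?j + (N - ?i + (N - ?j)) = 2 * N"
      using I[OF that] by simp
    finally show ?thesis .
  qed
  have "2 * N * d + 1 < card I"
    unfolding I_def card_bivariate_monomials by (simp add: N_def algebra_simps)
  then obtain k where k: "\<And>m. m \<in> I \<Longrightarrow> k m \<in> carrier R" "\<exists>m\<in>I. k m \<noteq> \<zero>"
      "\<And>n. n < 2 * N * d + 1 \<Longrightarrow> (\<Oplus>m\<in>I. k m \<otimes> up_ring.coeff P (V m) n) = \<zero>"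
    using R.exists_linear_relation[OF fin, of "2 * N * d + 1" "\<lambda>m n. up_ring.coeff P (V m) n"] V by auto
  \<comment> \<open>Coefficients up to \<open>2 N d\<close> vanish by the choice of
    \<open>k\<close>, the higher ones because of \<open>degV\<close>.\<close>
  have rel: "(\<Oplus>\<^bsub>P\<^esub>m\<in>I. k m \<odot>\<^bsub>P\<^esub> V m) = \<zero>\<^bsub>P\<^esub>"
  proof (rule up_eqI)
    fix n
    have "up_ring.coeff P (\<Oplus>\<^bsub>P\<^esub>m\<in>I. k m \<odot>\<^bsub>P\<^esub> V m) n = (\<Oplus>m\<in>I. up_ring.coeff P (k m \<odot>\<^bsub>P\<^esub> V m) n)"
      using k(1) V fin by (intro coeff_finsum) auto
    also have "\<dots> = (\<Oplus>m\<in>I. k m \<otimes> up_ring.coeff P (V m) n)"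
      using k(1) V by (intro R.finsum_cong') auto
    also have "\<dots> = \<zero>"
    proof (cases "n < 2 * N * d + 1")
      case False
      have "(\<Oplus>m\<in>I. k m \<otimes> up_ring.coeff P (V m) n) = (\<Oplus>m\<in>I. \<zero>)"
      proof (rule R.finsum_cong')
        fix m assume m: "m \<in> I"
        then have "up_ring.coeff P (V m) n = \<zero>"
          using degV[OF m] False V by (intro deg_aboveD) auto
        then show "k m \<otimes> up_ring.coeff P (V m) n = \<zero>"
          using k(1)[OF m] by simp
      qed auto
      then show ?thesis by simp
    qed (use k(3) in blast)
    finally show "up_ring.coeff P (\<Oplus>\<^bsub>P\<^esub>m\<in>I. k m \<odot>\<^bsub>P\<^esub> V m) n = up_ring.coeff P \<zero>\<^bsub>P\<^esub> n" by simp
  qed (use k(1) V in auto)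
  define f where "f m = (if m \<in> I then k m else \<zero>)" for m
  have fR: "f m \<in> carrier R" for m
    using k(1) by (simp add: f_def)
  have fI: "{m. f m \<noteq> \<zero>} \<subseteq> I"
    by (auto simp: f_def)
  have two: "{0, 1} \<subseteq> {..<length as}"
    using as(2) by auto
  have "f \<in> polys R (length as)"
    unfolding polys_iff[OF R.ring_axioms]
  proof (intro CollectI conjI allI impI)
    show "set_mset m \<subseteq> {..<length as}" if "f m \<noteq> \<zero>" for m
      using I(3)[of m] fI two that by blast
  qed (use fR fin fI finite_subset in auto)
  moreover have "\<exists>u. f u \<noteq> \<zero>"
    using k(2) by (auto simp: f_def)
  moreover have "eval_poly R ?A const_frac as f = \<zero>\<^bsub>?A\<^esub>"
  proof -
    let ?e = "\<lambda>m. \<Otimes>\<^bsub>?A\<^esub>i\<in>{..<length as}. (as ! i) [^]\<^bsub>?A\<^esub> count m i"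
    let ?QN = "?q Q [^]\<^bsub>?A\<^esub> (2 * N)"
    have e: "?e m \<in> carrier ?A" for m
      using nth by (intro A.finprod_closed) auto
    have qV: "const_frac (f m) \<otimes>\<^bsub>?A\<^esub> ?e m \<otimes>\<^bsub>?A\<^esub> ?QN = ?q (k m \<odot>\<^bsub>P\<^esub> V m)" if m: "m \<in> I" for m
    proof -
      let ?i = "count m 0" and ?j = "count m 1"
      let ?l = "N - ?i + (N - ?j)"
      have "?e m = (\<Otimes>\<^bsub>?A\<^esub>i\<in>{0, 1}. (as ! i) [^]\<^bsub>?A\<^esub> count m i)"
      proof (rule A.finprod_mono_neutral_cong_left[symmetric])
        fix i assume "i \<in> {..<length as} - {0, 1}"
        then have "i \<notin># m"
          using I(3)[OF m] by blast
        then show "as ! i [^]\<^bsub>?A\<^esub> count m i = \<one>\<^bsub>?A\<^esub>"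
          by (simp add: not_in_iff)
      qed (use two nth in auto)
      also have "\<dots> = as ! 0 [^]\<^bsub>?A\<^esub> ?i \<otimes>\<^bsub>?A\<^esub> as ! 1 [^]\<^bsub>?A\<^esub> ?j"
        using a by (subst A.finprod_insert) auto
      finally have em: "?e m = as ! 0 [^]\<^bsub>?A\<^esub> ?i \<otimes>\<^bsub>?A\<^esub> as ! 1 [^]\<^bsub>?A\<^esub> ?j" .
      have "2 * N = ?i + ?j + ?l"
        using I[OF m] by simp
      then have "?QN = ?q Q [^]\<^bsub>?A\<^esub> ?i \<otimes>\<^bsub>?A\<^esub> ?q Q [^]\<^bsub>?A\<^esub> ?j \<otimes>\<^bsub>?A\<^esub> ?q Q [^]\<^bsub>?A\<^esub> ?l"
        using c(1) by (simp only: A.nat_pow_mult q.hom_closed A.nat_pow_closed)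
      then have "?e m \<otimes>\<^bsub>?A\<^esub> ?QN = (as ! 0 [^]\<^bsub>?A\<^esub> ?i \<otimes>\<^bsub>?A\<^esub> ?q Q [^]\<^bsub>?A\<^esub> ?i) \<otimes>\<^bsub>?A\<^esub>
          (as ! 1 [^]\<^bsub>?A\<^esub> ?j \<otimes>\<^bsub>?A\<^esub> ?q Q [^]\<^bsub>?A\<^esub> ?j) \<otimes>\<^bsub>?A\<^esub> ?q Q [^]\<^bsub>?A\<^esub> ?l"
        unfolding em using a c(1) by (simp add: A.m_ac)
      also have "\<dots> = (?q p) [^]\<^bsub>?A\<^esub> ?i \<otimes>\<^bsub>?A\<^esub> (?q r) [^]\<^bsub>?A\<^esub> ?j \<otimes>\<^bsub>?A\<^esub> ?q Q [^]\<^bsub>?A\<^esub> ?l"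
        unfolding aQ[symmetric] bQ[symmetric] using a c(1) by (simp add: A.nat_pow_distrib)
      also have "\<dots> = ?q (V m)"
        unfolding V_def using c by simp
      finally have "?e m \<otimes>\<^bsub>?A\<^esub> ?QN = ?q (V m)" .
      then have "const_frac (f m) \<otimes>\<^bsub>?A\<^esub> ?e m \<otimes>\<^bsub>?A\<^esub> ?QN = const_frac (f m) \<otimes>\<^bsub>?A\<^esub> ?q (V m)"
        using e c(1) fR by (simp add: A.m_assoc)
      also have "\<dots> = ?q (up_ring.monom P (k m) 0 \<otimes>\<^bsub>P\<^esub> V m)"
        using m k(1) V by (simp add: f_def)
      also have "\<dots> = ?q (k m \<odot>\<^bsub>P\<^esub> V m)"
        using m k(1) V by (simp add: monom_mult_is_smult)
      finally show ?thesis .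
    qed
    have "eval_poly R ?A const_frac as f = (\<Oplus>\<^bsub>?A\<^esub>m\<in>I. const_frac (f m) \<otimes>\<^bsub>?A\<^esub> ?e m)"
      using fR as(1) fin fI by (intro g.eval_poly_superset) auto
    then have "eval_poly R ?A const_frac as f \<otimes>\<^bsub>?A\<^esub> ?QN =
        (\<Oplus>\<^bsub>?A\<^esub>m\<in>I. const_frac (f m) \<otimes>\<^bsub>?A\<^esub> ?e m \<otimes>\<^bsub>?A\<^esub> ?QN)"
      using fR e c(1) fin by (simp add: A.finsum_ldistr Pi_def)
    also have "\<dots> = (\<Oplus>\<^bsub>?A\<^esub>m\<in>I. ?q (k m \<odot>\<^bsub>P\<^esub> V m))"
      using qV k(1) V by (intro A.finsum_cong') auto
    also have "\<dots> = ?q (\<Oplus>\<^bsub>P\<^esub>m\<in>I. k m \<odot>\<^bsub>P\<^esub> V m)"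
      using k(1) V by (simp add: Pi_def comp_def)
    also have "\<dots> = \<zero>\<^bsub>?A\<^esub>"
      unfolding rel by simp
    \<comment> \<open>The value times a power of \<open>Q\<close> is zero; since that power is
      nonzero in the field, the value itself is zero.\<close>
    finally have 0: "eval_poly R ?A const_frac as f \<otimes>\<^bsub>?A\<^esub> ?QN = \<zero>\<^bsub>?A\<^esub>" .
    have "?q Q \<noteq> \<zero>\<^bsub>?A\<^esub>"
      using Q inj_onD[OF domain.inj_on_to_quot_field[OF UP_domain], of Q "\<zero>\<^bsub>P\<^esub>"] c(1) by auto
    then have "?QN \<noteq> \<zero>\<^bsub>?A\<^esub>"
      using c(1) by (intro A.nat_pow_nonzero) auto
    moreover have "eval_poly R ?A const_frac as f \<in> carrier ?A"
      unfolding eval_poly_def using fR e by (intro A.finsum_closed) auto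
    ultimately show ?thesis
      using 0 c(1) A.integral_iff by auto
  qed
  ultimately show ?thesis
    using g.alg_dependent_wrt_fieldI[OF assms(1,2) as(1)] by blast
qed

text \<open>The indeterminate is independent for every ordering, and embedding \<open>P\<close> in
  its quotient field preserves this. Every tuple of length at least 2 is dependent for every
  ordering, so both degrees equal 1.\<close>

lemma trdeg_quot_field:
  assumes "field R"
  shows "trdeg R (quot_field P) const_frac = 1"
    and "monomial_ordering ord \<Longrightarrow> trdeg_wrt ord R (quot_field P) const_frac = 1"
proof -
  interpret q: ring_hom_cring P "quot_field P" "to_quot_field P"
    by (rule domain.to_quot_field_hom_cring[OF UP_domain])
  interpret c: ring_hom_cring R P "\<lambda>k. up_ring.monom P k 0"
    by (intro ring_hom_cringI R.is_cring P.is_cring const_ring_hom)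
  let ?x = "up_ring.monom P \<one> 1"
  have "\<not> alg_dependent R P (\<lambda>k. up_ring.monom P k 0) [?x]"
    by (intro c.nonunit_alg_independent UP_domain indeterminate_nonunit) simp
  then have x: "\<not> alg_dependent R (quot_field P) const_frac [to_quot_field P ?x]"
    using q.alg_dependent_inj_hom[OF c.ring_hom_cring_axioms _ domain.inj_on_to_quot_field[OF UP_domain],
        of const_frac "[?x]"]
    by simp
  show wrt: "trdeg_wrt ord R (quot_field P) const_frac = 1" if "monomial_ordering ord" for ord
    unfolding trdeg_wrt_def
    using x that alg_dependent_quot_field[OF assms that]
    by (intro trdeg_of_eq_1[of "to_quot_field P ?x"]) (auto simp: alg_dependent_iff)
  show "trdeg R (quot_field P) const_frac = 1"
    unfolding trdeg_def
    using x alg_dependent_quot_field[OF assms lex_ordering_monomial_ordering]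
      lex_ordering_monomial_ordering
    by (intro trdeg_of_eq_1[of "to_quot_field P ?x"]) (auto simp: alg_dependent_iff)
qed

end

section \<open>Residue rings of nonmaximal primes and residue fields\<close>

text \<open>Take \<open>x\<close> outside \<open>P\<close> in a proper ideal \<open>J\<close>
  strictly containing \<open>P\<close>. If its class were invertible, 1 would lie in
  \<open>P + (x)\<close>, hence in \<open>J\<close>.\<close>

lemma quotient_nonunit:
  fixes R (structure)
  assumes "cring R" "primeideal P R" "\<not> maximalideal P R"
  obtains a where "a \<in> carrier (R Quot P)" "a \<noteq> \<zero>\<^bsub>R Quot P\<^esub>" "a \<notin> Units (R Quot P)"
proof -
  interpret P: primeideal P R by fact
  interpret \<pi>: ring_hom_cring R "R Quot P" "\<lambda>r. P +> r"
    by (rule P.rcos_ring_hom_cring)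
  obtain J where J: "ideal J R" "P \<subseteq> J" "J \<noteq> P" "J \<noteq> carrier R"
    using assms(3) maximalidealI[OF P.is_ideal] P.I_notcarr by blast
  interpret J: ideal J R by fact
  obtain x where x: "x \<in> J" "x \<notin> P"
    using J(2,3) by blast
  then have xR: "x \<in> carrier R"
    using J.Icarr by blast
  show thesis
  proof (rule that[of "P +> x"])
    show "P +> x \<in> carrier (R Quot P)"
      using xR by simp
    show "P +> x \<noteq> \<zero>\<^bsub>R Quot P\<^esub>"
      using P.rcos_eq_zero_iff[OF xR] x(2) by simp
    show "P +> x \<notin> Units (R Quot P)"
    proof
      assume "P +> x \<in> Units (R Quot P)"
      then obtain z where z: "z \<in> carrier (R Quot P)" "(P +> x) \<otimes>\<^bsub>R Quot P\<^esub> z = \<one>\<^bsub>R Quot P\<^esub>"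
        using \<pi>.S.Units_r_inv_ex by blast
      then obtain y where y: "y \<in> carrier R" "z = P +> y"
        unfolding FactRing_def A_RCOSETS_def' by auto
      have "P +> (x \<otimes> y) = P +> \<one>"
        using z(2) y xR \<pi>.hom_mult[of x y] \<pi>.hom_one by simp
      then have "\<one> \<in> P +> (x \<otimes> y)"
        using P.a_rcos_self[of \<one>] by simp
      then obtain p where p: "p \<in> P" "\<one> = p \<oplus> x \<otimes> y"
        unfolding a_r_coset_def' by blast
      have "p \<oplus> x \<otimes> y \<in> J"
        using p(1) J(2) x(1) y(1) by (intro J.a_closed J.I_r_closed) auto
      then show False
        using p(2) J(4) J.one_imp_carrier by simp
    qed
  qed
qed

text \<open>The lower bound comes from a nonzero nonunit of \<open>S\<close>, the equality from the
  surjection of \<open>R\<close> onto \<open>S\<close>, the next inequality from the injection of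
  \<open>S\<close> into \<open>A\<close>, and the last from fixing one ordering. The dimension and
  the Noetherian property hold as \<open>A\<close> is a field.\<close>

lemma quotient_adjoin_inverse:
  fixes R (structure)
  assumes R: "cring R" and P: "primeideal P R" "\<not> maximalideal P R"
    and b: "b \<in> carrier (R Quot P)" "b \<noteq> \<zero>\<^bsub>R Quot P\<^esub>"
    and field: "field (adjoin_inverse (R Quot P) b)"
  defines "S \<equiv> R Quot P"
  defines "A \<equiv> adjoin_inverse S b"
  defines "h \<equiv> \<lambda>r. to_adjoin_inverse S b (P +> r)"
  shows "krull_dim A = 0" "1 \<le> trdeg_self S" "trdeg_self S = trdeg R S (\<lambda>r. P +> r)"
    "trdeg R S (\<lambda>r. P +> r) \<le> trdeg R A h" "trdeg R A h \<le> trdeg_wrt lex_ordering R A h"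
    "fin_gen_algebra R A h" "noetherian_ring A"
proof -
  let ?\<pi> = "\<lambda>r. P +> r"
  interpret P: primeideal P R by fact
  interpret S: "domain" S
    unfolding S_def by (rule P.quotient_is_domain)
  have \<pi>: "ring_hom_cring R S ?\<pi>"
    unfolding S_def by (rule P.rcos_ring_hom_cring)
  have surj: "?\<pi> ` carrier R = carrier S"
    unfolding S_def FactRing_def A_RCOSETS_def' by auto
  interpret A: field A
    unfolding A_def S_def by (rule field)
  have bS: "b \<in> carrier S" "b \<noteq> \<zero>\<^bsub>S\<^esub>"
    using b by (simp_all add: S_def)
  interpret L: localized S "range (\<lambda>n :: nat. b [^]\<^bsub>S\<^esub> n)"
    by (rule S.localized_powers[OF bS(1)])
  have nz: "\<zero>\<^bsub>S\<^esub> \<notin> range (\<lambda>n :: nat. b [^]\<^bsub>S\<^esub> n)"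
    using S.nat_pow_nonzero[OF bS] by auto
  have \<iota>: "ring_hom_cring S A (to_adjoin_inverse S b)"
    unfolding A_def adjoin_inverse_def to_adjoin_inverse_def by (rule L.to_localization_hom_cring)
  have inj: "inj_on (to_adjoin_inverse S b) (carrier S)"
    unfolding to_adjoin_inverse_def by (rule L.inj_on_to_localization[OF S.domain_axioms nz])
  have id: "ring_hom_cring S S id"
    by (rule ring_hom_cringI[OF S.is_cring S.is_cring]) (rule ring_hom_memI, simp_all)
  show "krull_dim A = 0" "noetherian_ring A"
    by (rule A.krull_dim_eq_0 A.noetherian)+
  obtain a where a: "a \<in> carrier S" "a \<noteq> \<zero>\<^bsub>S\<^esub>" "a \<notin> Units S"
    unfolding S_def using quotient_nonunit[OF R P] .
  have "\<not> alg_dependent S S id [a]"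
    by (rule ring_hom_cring.nonunit_alg_independent[OF id S.domain_axioms a])
  then show "1 \<le> trdeg_self S"
    unfolding trdeg_def by (rule trdeg_of_ge_1[where a = a, OF a(1)])
  show "trdeg_self S = trdeg R S ?\<pi>"
    by (rule ring_hom_cring.trdeg_surj[OF \<pi> id _ surj S.one_not_zero, symmetric]) simp
  show "trdeg R S ?\<pi> \<le> trdeg R A h"
    by (rule ring_hom_cring.trdeg_inj_hom_le[OF \<iota> \<pi> _ inj]) (simp add: h_def)
  show "trdeg R A h \<le> trdeg_wrt lex_ordering R A h"
    by (rule trdeg_le_trdeg_wrt[OF lex_ordering_monomial_ordering])
  show "fin_gen_algebra R A h"
    unfolding A_def h_def by (rule fin_gen_adjoin_inverse[OF \<pi> surj bS(1)])
qed

section \<open>Copying the counterexample onto sets of polynomials\<close>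

text \<open>Send \<open>x\<close> to the \<open>e\<close>-image of its fibre under \<open>F\<close>.
  Fibres over distinct points of the image are nonempty and disjoint, and the injective
  \<open>e\<close> keeps them so.\<close>

lemma exists_inj_on_sets:
  fixes F :: "'d \<Rightarrow> 'x" and e :: "'d \<Rightarrow> 'y"
  assumes "inj_on e D"
  obtains \<phi> :: "'x \<Rightarrow> 'y set" where "inj_on \<phi> (F ` D)"
proof (rule that, rule inj_onI)
  fix x y
  assume "x \<in> F ` D" and eq: "e ` {d \<in> D. F d = x} = e ` {d \<in> D. F d = y}"
  then obtain d where d: "d \<in> D" "F d = x" by blast
  then obtain d' where "d' \<in> D" "F d' = y" "e d = e d'"
    using eq by blast
  with d show "x = y"
    using inj_onD[OF assms, of d d'] by simp
qed

lemma subfinite_algebra_fin_gen: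
  fixes B :: "(nat multiset \<Rightarrow> 'a) set ring" and R :: "('a, 'm) ring_scheme"
  assumes "fin_gen_algebra R B g"
  shows "subfinite_algebra R B g"
proof -
  have "id \<in> ring_hom B B"
    by (rule ring_hom_memI) simp_all
  then show ?thesis
    unfolding subfinite_algebra_def using assms
    by (intro conjI exI[of _ B] exI[of _ g] exI[of _ id]) (simp_all add: fin_gen_algebra_def)
qed

text \<open>The refuted assertions range over algebras whose elements are sets of polynomials, while
  the elements of the localization are sets of pairs of cosets. An isomorphic copy of the right type
  is therefore built.\<close>

lemma exists_subfinite_field:
  fixes R :: "('a, 'm) ring_scheme" (structure)
  assumes "cring R" "\<not> jacobson_ring R"
  obtains B :: "(nat multiset \<Rightarrow> 'a) set ring" and g
  where "subfinite_algebra R B g" "noetherian_ring B" "krull_dim B = 0" "1 \<le> trdeg R B g"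
proof -
  interpret R: cring R by fact
  obtain P b where P: "primeideal P R" "\<not> maximalideal P R"
    and b: "b \<in> carrier (R Quot P)" "b \<noteq> \<zero>\<^bsub>R Quot P\<^esub>" and field: "field (adjoin_inverse (R Quot P) b)"
    using not_jacobson_imp[OF assms] .
  define S where "S = R Quot P"
  define A where "A = adjoin_inverse S b"
  define h where "h = (\<lambda>r. to_adjoin_inverse S b (P +> r))"
  note A = quotient_adjoin_inverse[OF assms(1) P b field, folded S_def, folded A_def h_def]
  interpret A: field A
    unfolding A_def S_def by (rule field)
  interpret P: primeideal P R by (rule P)
  interpret S: "domain" S
    unfolding S_def by (rule P.quotient_is_domain)
  have bS: "b \<in> carrier S"
    using b by (simp add: S_def)
  let ?M = "range (\<lambda>n :: nat. b [^]\<^bsub>S\<^esub> n)"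
  interpret L: localized S ?M
    by (rule S.localized_powers[OF bS])
  let ?F = "\<lambda>(r, n :: nat). fraction S ?M (P +> r) (b [^]\<^bsub>S\<^esub> n)"
  \<comment> \<open>Every element of \<open>A\<close> is a fraction \<open>r/b^n\<close>, so
    \<open>A\<close> is the image of the pairs \<open>(r, n)\<close>.\<close>
  have car: "carrier A = ?F ` (carrier R \<times> UNIV)"
  proof
    show "carrier A \<subseteq> ?F ` (carrier R \<times> UNIV)"
    proof
      fix x assume "x \<in> carrier A"
      then obtain a s where a: "a \<in> carrier S" "s \<in> ?M" "x = fraction S ?M a s"
        unfolding A_def adjoin_inverse_def by (rule L.carrier_localizationE)
      from a(1) obtain r where r: "r \<in> carrier R" "a = P +> r"
        unfolding S_def FactRing_def A_RCOSETS_def' by auto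
      from a(2) obtain n :: nat where "s = b [^]\<^bsub>S\<^esub> n" by (rule rangeE)
      then have "x = ?F (r, n)"
        using a(3) r(2) by simp
      then show "x \<in> ?F ` (carrier R \<times> UNIV)"
        using r(1) by blast
    qed
    have "P +> r \<in> carrier S" if "r \<in> carrier R" for r
      using that unfolding S_def FactRing_def A_RCOSETS_def' by auto
    then show "?F ` (carrier R \<times> UNIV) \<subseteq> carrier A"
      unfolding A_def adjoin_inverse_def by auto
  qed
  have "\<one> \<noteq> \<zero>"
    using P.I_notcarr P.one_imp_carrier additive_subgroup.zero_closed[OF P.is_additive_subgroup] by metis
  \<comment> \<open>Codes the pair \<open>(r, n)\<close> as the polynomial
    \<open>r + x_0^(n+1)\<close>. The shift of the exponent keeps the second term apart from the
    constant term when \<open>n = 0\<close>, and 1 being nonzero makes \<open>n\<close>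
    recoverable.\<close>
  define e :: "'a \<times> nat \<Rightarrow> nat multiset \<Rightarrow> 'a" where
    "e = (\<lambda>(r, n) m. if m = {#} then r else if m = replicate_mset (Suc n) 0 then \<one> else \<zero>)"
  have "inj_on e (carrier R \<times> UNIV)"
  proof (rule inj_onI, clarify)
    fix r n s k assume eq: "e (r, n) = e (s, k)"
    have "e (s, k) (replicate_mset (Suc n) 0) = \<one>"
      unfolding eq[symmetric] by (simp add: e_def)
    then have "replicate_mset (Suc n) (0 :: nat) = replicate_mset (Suc k) 0"
      using \<open>\<one> \<noteq> \<zero>\<close> by (simp add: e_def split: if_splits)
    then have "size (replicate_mset (Suc n) (0 :: nat)) = size (replicate_mset (Suc k) (0 :: nat))"
      by simp
    moreover have "r = s"
      using fun_cong[OF eq, of "{#}"] by (simp add: e_def)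
    ultimately show "r = s \<and> n = k" by simp
  qed
  then obtain \<phi> :: "_ \<Rightarrow> (nat multiset \<Rightarrow> 'a) set" where \<phi>: "inj_on \<phi> (carrier A)"
    unfolding car by (rule exists_inj_on_sets)
  \<comment> \<open>The ring structure of \<open>A\<close> carried along the injection
    \<open>\<phi>\<close>; it is again a field.\<close>
  define B where "B = image_ring \<phi> A"
  interpret B: field B
    unfolding B_def by (rule A.inj_imp_image_ring_is_field[OF \<phi>])
  have "\<phi> \<in> ring_hom A B"
    using inj_imp_image_ring_iso[OF \<phi>] unfolding B_def ring_iso_def by blast
  then have hom: "ring_hom_cring A B \<phi>"
    by (intro ring_hom_cringI A.is_cring B.is_cring)
  have h: "ring_hom_cring R A h"
    using A(6) unfolding fin_gen_algebra_def by blast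
  have "\<phi> ` carrier A = carrier B"
    by (simp add: B_def image_ring_carrier)
  then have "fin_gen_algebra R B (\<lambda>r. \<phi> (h r))"
    by (rule fin_gen_algebra_image[OF A(6) hom])
  then have "subfinite_algebra R B (\<lambda>r. \<phi> (h r))"
    by (rule subfinite_algebra_fin_gen)
  moreover have "trdeg R A h \<le> trdeg R B (\<lambda>r. \<phi> (h r))"
    by (rule ring_hom_cring.trdeg_inj_hom_le[OF hom h _ \<phi>]) simp
  then have "1 \<le> trdeg R B (\<lambda>r. \<phi> (h r))"
    using A(2-4) by simp
  ultimately show thesis
    using that B.noetherian B.krull_dim_eq_0 by blast
qed

section \<open>Rational functions over a residue field, and the theorem\<close>

text \<open>The values over \<open>K\<close> are those of the rational function field; they do not
  change when coefficients are taken from \<open>R\<close>, since \<open>R\<close> maps onto the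
  nonzero ring \<open>K\<close>.\<close>

lemma trdeg_quot_field_UP_quotient:
  fixes R (structure)
  assumes R: "cring R" and M: "maximalideal M R"
  defines "K \<equiv> R Quot M"
  defines "S \<equiv> UP K"
  defines "A \<equiv> quot_field S"
  defines "g \<equiv> \<lambda>k. to_quot_field S (up_ring.monom S k 0)"
  defines "h \<equiv> \<lambda>r. g (M +> r)"
  shows "krull_dim A = 0" "trdeg K A g = 1" "trdeg R A h = 1" "trdeg_wrt lex_ordering R A h = 1"
proof -
  interpret M: maximalideal M R by fact
  interpret K: field K
    unfolding K_def by (rule M.quotient_is_field[OF R])
  interpret U: UP_domain K S
    by (intro UP_domain.intro K.domain_axioms) (simp add: S_def)
  interpret A: field A
    unfolding A_def by (rule domain.field_quot_field[OF U.UP_domain])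
  have \<pi>: "ring_hom_cring R K (\<lambda>r. M +> r)"
    unfolding K_def by (rule M.rcos_ring_hom_cring[OF R])
  have surj: "(\<lambda>r. M +> r) ` carrier R = carrier K"
    unfolding K_def FactRing_def A_RCOSETS_def' by auto
  have g: "ring_hom_cring K A g"
    unfolding A_def g_def by (rule U.const_frac_hom_cring)
  show "krull_dim A = 0"
    by (rule A.krull_dim_eq_0)
  show 1: "trdeg K A g = 1"
    unfolding A_def g_def by (rule U.trdeg_quot_field(1)[OF K.field_axioms])
  have 2: "trdeg_wrt lex_ordering K A g = 1"
    unfolding A_def g_def
    by (rule U.trdeg_quot_field(2)[OF K.field_axioms lex_ordering_monomial_ordering])
  show "trdeg R A h = 1"
    unfolding 1[symmetric]
    by (rule ring_hom_cring.trdeg_surj[OF \<pi> g _ surj K.one_not_zero]) (simp add: h_def)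
  show "trdeg_wrt lex_ordering R A h = 1"
    unfolding 2[symmetric]
    by (rule ring_hom_cring.trdeg_wrt_surj[OF \<pi> g _ surj K.one_not_zero]) (simp add: h_def)
qed

theorem mainTheorem2:
  fixes R :: "('a, 'm) ring_scheme"
  assumes "cring R"
  shows
    "(\<not> jacobson_ring R \<longrightarrow>
        (\<exists>P b. primeideal P R \<and> \<not> maximalideal P R \<and>
           b \<in> carrier (R Quot P) \<and> b \<noteq> \<zero>\<^bsub>R Quot P\<^esub> \<and> field (adjoin_inverse (R Quot P) b)) \<and>
        (\<forall>P b. primeideal P R \<and> \<not> maximalideal P R \<and>
           b \<in> carrier (R Quot P) \<and> b \<noteq> \<zero>\<^bsub>R Quot P\<^esub> \<and> field (adjoin_inverse (R Quot P) b) \<longrightarrow>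
           (let S = R Quot P;
                \<pi> = (\<lambda>r. P +>\<^bsub>R\<^esub> r);
                A = adjoin_inverse S b;
                h = (\<lambda>r. to_adjoin_inverse S b (\<pi> r))
            in krull_dim A = 0 \<and>
               1 \<le> trdeg_self S \<and>
               trdeg_self S = trdeg R S \<pi> \<and>
               trdeg R S \<pi> \<le> trdeg R A h \<and>
               trdeg R A h \<le> trdeg_wrt lex_ordering R A h \<and>
               fin_gen_algebra R A h \<and>
               noetherian_ring A)) \<and>
        \<not> (\<forall>(A :: (nat multiset \<Rightarrow> 'a) set ring) h. subfinite_algebra R A h \<longrightarrow>
              trdeg_wrt lex_ordering R A h = krull_dim A) \<and>
        \<not> (\<forall>(A :: (nat multiset \<Rightarrow> 'a) set ring) h. subfinite_algebra R A h \<and> noetherian_ring A \<longrightarrow>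
              trdeg R A h = krull_dim A)) \<and>
     (carrier R \<noteq> {\<zero>\<^bsub>R\<^esub>} \<longrightarrow>
        (\<forall>\<mm>. maximalideal \<mm> R \<longrightarrow>
           (let K = R Quot \<mm>;
                S = UP K;
                A = quot_field S;
                g = (\<lambda>k. to_quot_field S (monom S k 0));
                h = (\<lambda>r. g (\<mm> +>\<^bsub>R\<^esub> r))
            in krull_dim A = 0 \<and>
               (0 :: ereal) < 1 \<and>
               1 = trdeg K A g \<and>
               trdeg K A g = trdeg R A h \<and>
               trdeg R A h = trdeg_wrt lex_ordering R A h)))"
proof (intro conjI impI)
  assume nj: "\<not> jacobson_ring R"
  show "\<exists>P b. primeideal P R \<and> \<not> maximalideal P R \<and>
           b \<in> carrier (R Quot P) \<and> b \<noteq> \<zero>\<^bsub>R Quot P\<^esub> \<and> field (adjoin_inverse (R Quot P) b)"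
    using not_jacobson_imp[OF assms nj] by blast
  show "\<forall>P b. primeideal P R \<and> \<not> maximalideal P R \<and>
           b \<in> carrier (R Quot P) \<and> b \<noteq> \<zero>\<^bsub>R Quot P\<^esub> \<and> field (adjoin_inverse (R Quot P) b) \<longrightarrow>
           (let S = R Quot P;
                \<pi> = (\<lambda>r. P +>\<^bsub>R\<^esub> r);
                A = adjoin_inverse S b;
                h = (\<lambda>r. to_adjoin_inverse S b (\<pi> r))
            in krull_dim A = 0 \<and>
               1 \<le> trdeg_self S \<and>
               trdeg_self S = trdeg R S \<pi> \<and>
               trdeg R S \<pi> \<le> trdeg R A h \<and>
               trdeg R A h \<le> trdeg_wrt lex_ordering R A h \<and>
               fin_gen_algebra R A h \<and>
               noetherian_ring A)"
    unfolding Let_def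
    by (intro allI impI conjI; elim conjE; rule quotient_adjoin_inverse[OF assms]; assumption)
  \<comment> \<open>One field refutes both assertions: its dimension is 0, while its transcendence
    degree, and with it the lexicographic one, is at least 1.\<close>
  obtain B :: "(nat multiset \<Rightarrow> 'a) set ring" and g where
    B: "subfinite_algebra R B g" "noetherian_ring B" "krull_dim B = 0" "1 \<le> trdeg R B g"
    using exists_subfinite_field[OF assms nj] .
  from B(4) have "trdeg R B g \<noteq> krull_dim B"
    unfolding B(3) by auto
  with B show "\<not> (\<forall>(A :: (nat multiset \<Rightarrow> 'a) set ring) h. subfinite_algebra R A h \<and> noetherian_ring A \<longrightarrow>
              trdeg R A h = krull_dim A)"
    by blast
  have "1 \<le> trdeg_wrt lex_ordering R B g"
    using B(4) trdeg_le_trdeg_wrt[OF lex_ordering_monomial_ordering] by (rule order_trans)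
  then have "trdeg_wrt lex_ordering R B g \<noteq> krull_dim B"
    unfolding B(3) by auto
  with B(1) show "\<not> (\<forall>(A :: (nat multiset \<Rightarrow> 'a) set ring) h. subfinite_algebra R A h \<longrightarrow>
              trdeg_wrt lex_ordering R A h = krull_dim A)"
    by blast
next
  show "\<forall>\<mm>. maximalideal \<mm> R \<longrightarrow>
           (let K = R Quot \<mm>;
                S = UP K;
                A = quot_field S;
                g = (\<lambda>k. to_quot_field S (monom S k 0));
                h = (\<lambda>r. g (\<mm> +>\<^bsub>R\<^esub> r))
            in krull_dim A = 0 \<and>
               (0 :: ereal) < 1 \<and>
               1 = trdeg K A g \<and>
               trdeg K A g = trdeg R A h \<and>
               trdeg R A h = trdeg_wrt lex_ordering R A h)"
    unfolding Let_def using trdeg_quot_field_UP_quotient[OF assms] by simp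
qed

end
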